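(* Let $(\boldsymbol V,\Phi)$ be a nicely growing primitive lattice substitution system, and let $(\boldsymbol V',\Phi')$ be the admissible primitive lattice substitution system derived from $(\boldsymbol V,\Phi)$ by coloring each lattice point according to the $R$-cluster of $\boldsymbol V$ around it (the construction described in the context). If $\boldsymbol V'$ consists of model sets (i.e. each component $V'_i$ is a model set), then so does $\boldsymbol V$ (i.e. each component $V_i$ is a model set).
   Context: A matrix function system (MFS) is an $m\times m$ matrix $\Phi=(\Phi_{ij})$ whose entries are finite (possibly empty) sets of maps $x\mapsto Qx+a_{ijk}$ on $\mathbb R^d$, where $Q$ is one fixed expansive linear map (all eigenvalues of modulus $>1$) and $a_{ijk}\in\mathbb R^d$. It is primitive if its substitution matrix $S(\Phi)=(\#\Phi_{ij})_{i,j}$ is primitive, i.e. some power has only strictly positive entries. Powers are defined by composition: $(\Phi^{k+1})_{ij}=\bigcup_{\ell}\{g\circ f : g\in(\Phi^k)_{i\ell},\ f\in\Phi_{\ell j}\}$. For a vector $\boldsymbol V=(V_1,\dots,V_m)^T$ of subsets of $\mathbb R^d$, $\Phi\boldsymbol V=(W_1,\dots,W_m)$ with $W_i=\bigcup_j\bigcup_{f\in\Phi_{ij}}f(V_j)$, and $\operatorname{supp}(\boldsymbol V)=\bigcup_iV_i$. A lattice substitution system (LSS) with $m$ components is a pair $(\boldsymbol V,\Phi)$ with $\Phi\boldsymbol V=\boldsymbol V$, the $V_i$ mutually disjoint, the unions $V_i=\bigcup_{j}\bigcup_{f\in\Phi_{ij}}f(V_j)$ pairwise disjoint for every $i$, and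 $L:=\operatorname{supp}(\boldsymbol V)$ a lattice in $\mathbb R^d$. It is primitive if $\Phi$ is. A primitive LSS is admissible if the translational parts of all maps in $\Phi$ belong to one fixed system of representatives (containing $0$) in $L$ of $L/QL$. Write $\boldsymbol V\cap A=(V_1\cap A,\dots,V_m\cap A)$; an $R$-cluster is $\boldsymbol V\cap(x+R\mathbb B^d)$, $\mathbb B^d$ the closed unit ball. Standing assumption on $(\boldsymbol V,\Phi)$: for every $r>0$, every $r$-cluster of $\boldsymbol V$ is, up to translation, contained in $\Phi^k(\boldsymbol v)$ for some $k\in\mathbb N$ and some single point $\boldsymbol v$ of some type $i$ (a vector of sets whose $i$-th entry is a one-point set, all others being empty). Nicely growing: let $F$ be a fundamental domain of $L$; $(\boldsymbol V,\Phi)$ is nicely growing if there is $R>0$ such that for all $t\in L$: $L\cap(Qt+QF+R\mathbb B^d)\subset\operatorname{supp}(\Phi(\boldsymbol V\cap(t+R\mathbb B^d)))$. Construction of $(\boldsymbol V',\Phi')$: take such an $R$, with $F=\{\sum_{i=1}^d\lambda_iu_i : 0\le\lambda_i<1\}$ for a basis $u_1,\dots,u_d$ of $L$. Let $C^{(1)},\dots,C^{(n)}$ (centered at the origin) represent the finitely many translation classes of $R$-clusters $\boldsymbol V\cap(x+R\mathbb B^d)$, $x\in L$. Put $V'_i=\{x\in L : \boldsymbol V\cap(x+R\mathbb B^d)=C^{(i)}+x\}$ and $\boldsymbol V'=(V'_1,\dots,V'_n)$. For $1\le i,j\le n$, choose any $x\in V'_j$ and put $\Phi'_{ij}=\{y\mapsto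 Qy+(b-Qx) : b\in(Qx+QF)\cap V'_i\}$ (this does not depend on the choice of $x\in V'_j$). Model sets: a cut and project scheme consists of a locally compact Abelian group $H$ and a lattice $\tilde L\subset\mathbb R^d\times H$ (discrete subgroup with compact quotient) such that the canonical projection $\pi:\mathbb R^d\times H\to\mathbb R^d$ is injective on $\tilde L$ and the canonical projection $\pi_{\rm int}:\mathbb R^d\times H\to H$ maps $\tilde L$ onto a dense subset of $H$. A model set in $\mathbb R^d$ is a set which, up to translation, has the form $\Lambda(\Omega)=\{\pi(x) : x\in\tilde L,\ \pi_{\rm int}(x)\in\Omega\}$ for some cut and project scheme, where $\Omega\subset H$ has nonempty interior and compact closure. *)

theory Defs
  imports "HOL-Analysis.Analysis" "HOL-Algebra.Coset"
begin

no_notation Congruence.eq_closure_of (\<open>closure'_of\<index>\<close>)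

section \<open>Matrix function systems\<close>

text \<open>
  An \<open>m \<times> m\<close> matrix function system is a function \<open>\<Phi>\<close> of two indices, of which only the entries
  with both indices below \<open>m\<close> matter; likewise only the components \<open>V i\<close> with \<open>i < m\<close> of a vector of
  sets matter.
\<close>

definition expansive :: "real^'d^'d \<Rightarrow> bool" where
  "expansive Q \<longleftrightarrow>
     (\<forall>(\<mu>::complex) (v::complex^'d).
        v \<noteq> 0 \<longrightarrow> map_matrix complex_of_real Q *v v = \<mu> *s v \<longrightarrow> norm \<mu> > 1)"

definition matrix_function_system ::
  "nat \<Rightarrow> real^'d^'d \<Rightarrow> (nat \<Rightarrow> nat \<Rightarrow> (real^'d \<Rightarrow> real^'d) set) \<Rightarrow> bool" where
  "matrix_function_system m Q \<Phi> \<longleftrightarrow> expansive Q \<and>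
     (\<forall>i<m. \<forall>j<m. finite (\<Phi> i j) \<and> (\<forall>f\<in>\<Phi> i j. \<exists>a. f = (\<lambda>x. Q *v x + a)))"

fun mfs_power ::
  "nat \<Rightarrow> (nat \<Rightarrow> nat \<Rightarrow> ('a \<Rightarrow> 'a) set) \<Rightarrow> nat \<Rightarrow> nat \<Rightarrow> nat \<Rightarrow> ('a \<Rightarrow> 'a) set" where
  "mfs_power m \<Phi> 0 i j = (if i = j then {id} else {})"
| "mfs_power m \<Phi> (Suc k) i j = (\<Union>l<m. {g \<circ> f |g f. g \<in> mfs_power m \<Phi> k i l \<and> f \<in> \<Phi> l j})"

definition mfs_apply ::
  "nat \<Rightarrow> (nat \<Rightarrow> nat \<Rightarrow> ('a \<Rightarrow> 'a) set) \<Rightarrow> (nat \<Rightarrow> 'a set) \<Rightarrow> nat \<Rightarrow> 'a set" where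
  "mfs_apply m \<Phi> V i = (\<Union>j<m. \<Union>f\<in>\<Phi> i j. f ` V j)"

definition supp :: "nat \<Rightarrow> (nat \<Rightarrow> 'a set) \<Rightarrow> 'a set" where
  "supp m V = (\<Union>i<m. V i)"

definition substitution_matrix ::
  "(nat \<Rightarrow> nat \<Rightarrow> ('a \<Rightarrow> 'a) set) \<Rightarrow> nat \<Rightarrow> nat \<Rightarrow> nat" where
  "substitution_matrix \<Phi> i j = card (\<Phi> i j)"

fun matrix_power :: "nat \<Rightarrow> (nat \<Rightarrow> nat \<Rightarrow> nat) \<Rightarrow> nat \<Rightarrow> nat \<Rightarrow> nat \<Rightarrow> nat" where
  "matrix_power m S 0 i j = (if i = j then 1 else 0)"
| "matrix_power m S (Suc k) i j = (\<Sum>l<m. matrix_power m S k i l * S l j)"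

definition primitive_mfs :: "nat \<Rightarrow> (nat \<Rightarrow> nat \<Rightarrow> ('a \<Rightarrow> 'a) set) \<Rightarrow> bool" where
  "primitive_mfs m \<Phi> \<longleftrightarrow>
     (\<exists>k>0. \<forall>i<m. \<forall>j<m. matrix_power m (substitution_matrix \<Phi>) k i j > 0)"


section \<open>Lattice substitution systems\<close>

definition lattice_basis :: "('d \<Rightarrow> real^'d) \<Rightarrow> (real^'d) set \<Rightarrow> bool" where
  "lattice_basis u L \<longleftrightarrow> inj u \<and> independent (range u) \<and>
     L = {(\<Sum>i\<in>UNIV. of_int (c i) *\<^sub>R u i) |c::'d \<Rightarrow> int. True}"

definition fundamental_parallelepiped :: "('d::finite \<Rightarrow> real^'d) \<Rightarrow> (real^'d) set" where
  "fundamental_parallelepiped u =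
     {(\<Sum>i\<in>UNIV. c i *\<^sub>R u i) |c::'d \<Rightarrow> real. \<forall>i. 0 \<le> c i \<and> c i < 1}"

definition lattice_substitution_system ::
  "nat \<Rightarrow> real^'d^'d \<Rightarrow> (nat \<Rightarrow> (real^'d) set) \<Rightarrow>
     (nat \<Rightarrow> nat \<Rightarrow> (real^'d \<Rightarrow> real^'d) set) \<Rightarrow> bool" where
  "lattice_substitution_system m Q V \<Phi> \<longleftrightarrow>
     matrix_function_system m Q \<Phi> \<and>
     (\<forall>i<m. mfs_apply m \<Phi> V i = V i) \<and>
     disjoint_family_on V {..<m} \<and>
     (\<forall>i<m. disjoint_family_on (\<lambda>(j, f). f ` V j) (SIGMA j:{..<m}. \<Phi> i j)) \<and>
     (\<exists>u. lattice_basis u (supp m V))"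

text \<open>The cluster \<open>V \<inter> A\<close> is the vector \<open>cut V A\<close>; clusters are compared componentwise below \<open>m\<close>.\<close>

definition cut :: "(nat \<Rightarrow> 'a set) \<Rightarrow> 'a set \<Rightarrow> nat \<Rightarrow> 'a set" where
  "cut V A i = V i \<inter> A"

definition single_point :: "nat \<Rightarrow> 'a \<Rightarrow> nat \<Rightarrow> 'a set" where
  "single_point i p = (\<lambda>j. if j = i then {p} else {})"

definition clusters_from_points ::
  "nat \<Rightarrow> (nat \<Rightarrow> (real^'d) set) \<Rightarrow> (nat \<Rightarrow> nat \<Rightarrow> (real^'d \<Rightarrow> real^'d) set) \<Rightarrow> bool" where
  "clusters_from_points m V \<Phi> \<longleftrightarrow>
     (\<forall>r>0. \<forall>x. \<exists>k. \<exists>i<m. \<exists>p t. \<forall>j<m.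
        (+) t ` cut V (cball x r) j \<subseteq> mfs_apply m (mfs_power m \<Phi> k) (single_point i p) j)"

text \<open>\<open>growth_region Q F R t\<close> is \<open>Qt + QF + RB\<close>, with \<open>B\<close> the closed unit ball.\<close>

definition growth_region ::
  "real^'d^'d \<Rightarrow> (real^'d) set \<Rightarrow> real \<Rightarrow> real^'d \<Rightarrow> (real^'d) set" where
  "growth_region Q F R t = {Q *v t + Q *v f + z |f z. f \<in> F \<and> z \<in> cball 0 R}"

definition nicely_growing_with ::
  "nat \<Rightarrow> real^'d^'d \<Rightarrow> (nat \<Rightarrow> (real^'d) set) \<Rightarrow>
     (nat \<Rightarrow> nat \<Rightarrow> (real^'d \<Rightarrow> real^'d) set) \<Rightarrow> (real^'d) set \<Rightarrow> real \<Rightarrow> bool" where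
  "nicely_growing_with m Q V \<Phi> F R \<longleftrightarrow> R > 0 \<and>
     (\<forall>t\<in>supp m V. supp m V \<inter> growth_region Q F R t
        \<subseteq> supp m (mfs_apply m \<Phi> (cut V (cball t R))))"

definition nicely_growing ::
  "nat \<Rightarrow> real^'d^'d \<Rightarrow> (nat \<Rightarrow> (real^'d) set) \<Rightarrow>
     (nat \<Rightarrow> nat \<Rightarrow> (real^'d \<Rightarrow> real^'d) set) \<Rightarrow> (real^'d) set \<Rightarrow> bool" where
  "nicely_growing m Q V \<Phi> F \<longleftrightarrow> (\<exists>R. nicely_growing_with m Q V \<Phi> F R)"


section \<open>The derived system\<close>

definition has_cluster ::
  "nat \<Rightarrow> (nat \<Rightarrow> (real^'d) set) \<Rightarrow> real \<Rightarrow> real^'d \<Rightarrow> (nat \<Rightarrow> (real^'d) set) \<Rightarrow> bool" where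
  "has_cluster m V R x C \<longleftrightarrow> (\<forall>k<m. cut V (cball x R) k = (+) x ` C k)"

text \<open>
  \<open>C 0, \<dots>, C (n - 1)\<close> represent the translation classes of \<open>R\<close>-clusters around points of
  \<open>L = supp m V\<close>, each moved so as to be centred at the origin. Since \<open>L \<inter> cball x R\<close> is
  finite with centroid \<open>x\<close>, a translation between two such clusters necessarily maps centre to
  centre, so that comparing the centred clusters is the same as comparing translation classes.
\<close>

definition cluster_representatives ::
  "nat \<Rightarrow> (nat \<Rightarrow> (real^'d) set) \<Rightarrow> real \<Rightarrow> nat \<Rightarrow> (nat \<Rightarrow> nat \<Rightarrow> (real^'d) set) \<Rightarrow> bool" where
  "cluster_representatives m V R n C \<longleftrightarrow>
     (\<forall>i<n. \<exists>x\<in>supp m V. has_cluster m V R x (C i)) \<and>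
     (\<forall>x\<in>supp m V. \<exists>!i. i < n \<and> has_cluster m V R x (C i))"

definition derived_system ::
  "nat \<Rightarrow> real^'d^'d \<Rightarrow> (nat \<Rightarrow> (real^'d) set) \<Rightarrow> (real^'d) set \<Rightarrow> real \<Rightarrow> nat \<Rightarrow>
     (nat \<Rightarrow> nat \<Rightarrow> (real^'d) set) \<Rightarrow> (nat \<Rightarrow> (real^'d) set) \<Rightarrow>
     (nat \<Rightarrow> nat \<Rightarrow> (real^'d \<Rightarrow> real^'d) set) \<Rightarrow> bool" where
  "derived_system m Q V F R n C V' \<Phi>' \<longleftrightarrow>
     cluster_representatives m V R n C \<and>
     (\<forall>i<n. V' i = {x \<in> supp m V. has_cluster m V R x (C i)}) \<and>
     (\<forall>i<n. \<forall>j<n. \<exists>x\<in>V' j.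
        \<Phi>' i j = {(\<lambda>y. Q *v y + (b - Q *v x)) |b. b \<in> (\<lambda>f. Q *v x + Q *v f) ` F \<inter> V' i})"


section \<open>Model sets\<close>

definition lca_group :: "('h, 'b) monoid_scheme \<Rightarrow> 'h topology \<Rightarrow> bool" where
  "lca_group H T \<longleftrightarrow> comm_group H \<and> topspace T = carrier H \<and>
     Hausdorff_space T \<and> locally_compact_space T \<and>
     continuous_map (prod_topology T T) T (\<lambda>(x, y). x \<otimes>\<^bsub>H\<^esub> y) \<and>
     continuous_map T T (\<lambda>x. inv\<^bsub>H\<^esub> x)"

definition euclidean_group :: "(real^'d) monoid" where
  "euclidean_group = \<lparr>carrier = UNIV, mult = (+), one = 0\<rparr>"

text \<open>A lattice in a topological group: a discrete subgroup with compact quotient.\<close>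

definition cocompact_lattice :: "('g, 'b) monoid_scheme \<Rightarrow> 'g topology \<Rightarrow> 'g set \<Rightarrow> bool" where
  "cocompact_lattice G X \<Lambda> \<longleftrightarrow> subgroup \<Lambda> G \<and>
     subtopology X \<Lambda> = discrete_topology \<Lambda> \<and>
     (\<exists>Y. quotient_map X Y (\<lambda>x. \<Lambda> #>\<^bsub>G\<^esub> x) \<and> compact_space Y)"

definition cut_and_project_scheme ::
  "('h, 'b) monoid_scheme \<Rightarrow> 'h topology \<Rightarrow> ((real^'d) \<times> 'h) set \<Rightarrow> bool" where
  "cut_and_project_scheme H T Lt \<longleftrightarrow> lca_group H T \<and>
     cocompact_lattice (euclidean_group \<times>\<times> H) (prod_topology euclidean T) Lt \<and>
     inj_on fst Lt \<and> T closure_of (snd ` Lt) = topspace T"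

definition projected_set :: "((real^'d) \<times> 'h) set \<Rightarrow> 'h set \<Rightarrow> (real^'d) set" where
  "projected_set Lt \<Omega> = fst ` {z \<in> Lt. snd z \<in> \<Omega>}"

definition window :: "'h topology \<Rightarrow> 'h set \<Rightarrow> bool" where
  "window T \<Omega> \<longleftrightarrow> \<Omega> \<subseteq> topspace T \<and> T interior_of \<Omega> \<noteq> {} \<and> compactin T (T closure_of \<Omega>)"

text \<open>
  HOL cannot quantify over the type carrying the internal group \<open>H\<close>. Fixing \<open>(real^'d) set set\<close>
  as that type loses nothing: this is the lemma \<open>model_setI\<close> below, which admits an internal
  group on an arbitrary type.
\<close>

definition model_set :: "(real^'d) set \<Rightarrow> bool" where
  "model_set A \<longleftrightarrow>
     (\<exists>(H :: (real^'d) set set monoid) T Lt \<Omega> t.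
        cut_and_project_scheme H T Lt \<and> window T \<Omega> \<and> A = (+) t ` projected_set Lt \<Omega>)"


subsection \<open>Independence of the type carrying the internal group\<close>

lemma homeomorphic_map_on_image:
  assumes "inj_on f (topspace X)"
  obtains Y where "homeomorphic_map X Y f"
proof -
  define g where "g = inv_into (topspace X) f"
  define Y where "Y = pullback_topology (f ` topspace X) g X"
  have gf: "g (f x) = x" if "x \<in> topspace X" for x
    using that assms by (simp add: g_def)
  have tY: "topspace Y = f ` topspace X"
    by (auto simp: Y_def topspace_pullback_topology gf)
  have "homeomorphic_maps X Y f g"
    unfolding homeomorphic_maps_def
  proof (intro conjI ballI)
    have "continuous_map X X (g \<circ> f)"
      by (rule continuous_map_eq[of X X id]) (auto simp: gf)
    then show "continuous_map X Y f"
      unfolding Y_def by (intro continuous_map_pullback') auto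
    have "continuous_map Y X (id \<circ> g)"
      unfolding Y_def by (intro continuous_map_pullback) auto
    then show "continuous_map Y X g" by simp
  qed (auto simp: tY gf)
  then show thesis
    using that homeomorphic_map_maps by blast
qed

text \<open>
  Given a dense subset that injects into \<open>'a\<close>, points of a Hausdorff space are separated by the
  traces of their neighbourhoods on that subset.
\<close>

lemma Hausdorff_dense_embedding:
  fixes T :: "'h topology" and P :: "('a \<times> 'h) set"
  assumes "Hausdorff_space T" "T closure_of (snd ` P) = topspace T" "inj_on fst P"
  obtains e :: "'h \<Rightarrow> 'a set set" where "inj_on e (topspace T)"
proof -
  define tr where "tr N = fst ` {z \<in> P. snd z \<in> N}" for N
  define e where "e h = {tr N |N. openin T N \<and> h \<in> N}" for h
  have "inj_on e (topspace T)"
  proof (rule inj_onI, rule ccontr)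
    fix x y assume xy: "x \<in> topspace T" "y \<in> topspace T" "e x = e y" "x \<noteq> y"
    obtain U W where UW: "openin T U" "openin T W" "x \<in> U" "y \<in> W" "disjnt U W"
      using assms(1) xy unfolding Hausdorff_space_def by metis
    have "tr U \<in> e y"
      using UW xy(3) by (auto simp: e_def)
    then obtain N where N: "openin T N" "y \<in> N" "tr U = tr N"
      by (auto simp: e_def)
    have o: "openin T (N \<inter> W)" and y: "y \<in> N \<inter> W"
      using N UW by auto
    have "y \<in> T closure_of (snd ` P)"
      using assms(2) xy by simp
    then obtain z where z: "z \<in> P" "snd z \<in> N \<inter> W"
      using o y unfolding in_closure_of by blast
    then have "fst z \<in> tr U"
      using N by (auto simp: tr_def)
    then obtain z' where z': "z' \<in> P" "snd z' \<in> U" "fst z' = fst z"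
      by (auto simp: tr_def)
    with z assms(3) have "z' = z"
      by (auto dest: inj_onD)
    with z z' UW show False
      by (auto simp: disjnt_def)
  qed
  then show thesis using that by blast
qed

lemma cocompact_lattice_transport:
  assumes G: "group G" and G': "group G'" and h: "h \<in> iso G G'"
    and hom: "homeomorphic_map X X' h" and X: "topspace X = carrier G"
    and L: "cocompact_lattice G X \<Lambda>"
  shows "cocompact_lattice G' X' (h ` \<Lambda>)"
proof -
  have sub: "subgroup \<Lambda> G" and disc: "subtopology X \<Lambda> = discrete_topology \<Lambda>"
    using L by (auto simp: cocompact_lattice_def)
  obtain Y where Y: "quotient_map X Y (\<lambda>x. \<Lambda> #>\<^bsub>G\<^esub> x)" "compact_space Y"
    using L by (auto simp: cocompact_lattice_def)
  have \<Lambda>: "\<Lambda> \<subseteq> carrier G"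
    using sub by (rule subgroup.subset)
  interpret h: group_hom G G' h
    using G G' h by (auto simp: group_hom_def group_hom_axioms_def iso_def)
  have inj: "inj_on h (carrier G)" and surj: "h ` carrier G = carrier G'"
    using h by (auto simp: iso_def bij_betw_def)
  have tX': "topspace X' = carrier G'"
    using homeomorphic_imp_surjective_map[OF hom] X surj by simp
  have "homeomorphic_map (subtopology X \<Lambda>) (subtopology X' (h ` \<Lambda>)) h"
    using hom \<Lambda> X tX' surj by (intro homeomorphic_map_subtopologies) (auto simp: Int_absorb1)
  then have "subtopology X' (h ` \<Lambda>) = discrete_topology (h ` \<Lambda>)"
  proof -
    assume hs: "homeomorphic_map (subtopology X \<Lambda>) (subtopology X' (h ` \<Lambda>)) h"
    have t: "topspace (subtopology X' (h ` \<Lambda>)) = h ` \<Lambda>"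
      using \<Lambda> tX' surj by auto
    have "openin (subtopology X' (h ` \<Lambda>)) {y}" if y: "y \<in> h ` \<Lambda>" for y
    proof -
      obtain x where x: "x \<in> \<Lambda>" "y = h x"
        using y by blast
      have "openin (subtopology X \<Lambda>) {x}"
        using x by (simp add: disc)
      moreover have "open_map (subtopology X \<Lambda>) (subtopology X' (h ` \<Lambda>)) h"
        using hs by (rule homeomorphic_imp_open_map)
      ultimately have "openin (subtopology X' (h ` \<Lambda>)) (h ` {x})"
        unfolding open_map_def by blast
      then show ?thesis using x by simp
    qed
    then show ?thesis
      using t discrete_topology_unique by metis
  qed
  moreover have "subgroup (h ` \<Lambda>) G'"
    using sub by (rule h.subgroup_img_is_subgroup)
  moreover have "\<exists>Y'. quotient_map X' Y' (\<lambda>x. (h ` \<Lambda>) #>\<^bsub>G'\<^esub> x) \<and> compact_space Y'"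
  proof -
    define k where "k = inv_into (carrier G) h"
    have hk: "homeomorphic_map X' X k"
    proof -
      obtain g where g: "homeomorphic_maps X X' h g"
        using hom homeomorphic_map_maps by blast
      have "g y = k y" if "y \<in> topspace X'" for y
      proof -
        have "g y \<in> topspace X" "h (g y) = y"
          using g that by (auto simp: homeomorphic_maps_def continuous_map_def)
        then have "k (h (g y)) = g y"
          unfolding k_def using inj X inv_into_f_f by metis
        with \<open>h (g y) = y\<close> show ?thesis by simp
      qed
      moreover have "homeomorphic_map X' X g"
        using g homeomorphic_maps_sym homeomorphic_maps_imp_map by blast
      ultimately show ?thesis
        using homeomorphic_map_eq by metis
    qed
    have tY: "topspace Y = (\<lambda>x. \<Lambda> #>\<^bsub>G\<^esub> x) ` carrier G"
      using quotient_imp_surjective_map[OF Y(1)] X by simp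
    have cosets: "U \<subseteq> carrier G" if "U \<in> topspace Y" for U
      using that \<Lambda> h.G.r_coset_subset_G by (auto simp: tY)
    have "inj_on ((`) h) (topspace Y)"
    proof (rule inj_onI)
      fix U W assume "U \<in> topspace Y" "W \<in> topspace Y" "h ` U = h ` W"
      then show "U = W"
        using inj_on_image_eq_iff[OF inj cosets cosets] by simp
    qed
    then obtain Y' where Y': "homeomorphic_map Y Y' ((`) h)"
      by (rule homeomorphic_map_on_image)
    have "quotient_map X' Y' (((`) h) \<circ> ((\<lambda>x. \<Lambda> #>\<^bsub>G\<^esub> x) \<circ> k))"
      using hk Y' unfolding homeomorphic_map_def
      by (intro quotient_map_compose[OF quotient_map_compose[OF _ Y(1)]]) auto
    then have "quotient_map X' Y' (\<lambda>x. (h ` \<Lambda>) #>\<^bsub>G'\<^esub> x)"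
    proof (rule quotient_map_eq)
      fix y assume "y \<in> topspace X'"
      then obtain x where x: "x \<in> carrier G" "y = h x"
        using tX' surj by blast
      then have "k y = x"
        unfolding k_def using inj by simp
      moreover have "h ` (\<Lambda> #>\<^bsub>G\<^esub> x) = (h ` \<Lambda>) #>\<^bsub>G'\<^esub> h x"
        using x \<Lambda> by (force simp: r_coset_def)
      ultimately show "(((`) h) \<circ> ((\<lambda>x. \<Lambda> #>\<^bsub>G\<^esub> x) \<circ> k)) y = (h ` \<Lambda>) #>\<^bsub>G'\<^esub> y"
        using x by simp
    qed
    moreover have "compact_space Y'"
      using Y(2) Y' homeomorphic_compact_space homeomorphic_map_imp_homeomorphic_space by blast
    ultimately show ?thesis by blast
  qed
  ultimately show ?thesis
    by (simp add: cocompact_lattice_def)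
qed

lemma group_euclidean_group: "group euclidean_group"
  by (rule groupI) (auto simp: euclidean_group_def add.assoc intro: exI[of _ "- _"])

lemma lca_group_transport:
  fixes H :: "('h, 'b) monoid_scheme" and e :: "'h \<Rightarrow> 'g"
  assumes H: "lca_group H T" and e: "inj_on e (carrier H)"
  obtains H' :: "'g monoid" and T' where "lca_group H' T'" "e \<in> iso H H'" "homeomorphic_map T T' e"
proof -
  interpret H: comm_group H
    using H by (simp add: lca_group_def)
  have tT: "topspace T = carrier H"
    using H by (simp add: lca_group_def)
  obtain T' where T': "homeomorphic_map T T' e"
    using homeomorphic_map_on_image[of e T] e tT by metis
  define k where "k = inv_into (carrier H) e"
  have ke: "k (e x) = x" if "x \<in> carrier H" for x
    unfolding k_def using that e by simp
  define H' where "H' = \<lparr>carrier = e ` carrier H, mult = (\<lambda>a b. e (k a \<otimes>\<^bsub>H\<^esub> k b)), one = e \<one>\<^bsub>H\<^esub>\<rparr>"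
  have cH': "carrier H' = e ` carrier H"
    by (simp add: H'_def)
  have tT': "topspace T' = carrier H'"
    using homeomorphic_imp_surjective_map[OF T'] tT cH' by simp
  have comm: "comm_group H'"
  proof (rule comm_groupI)
    fix a assume "a \<in> carrier H'"
    then obtain x where x: "x \<in> carrier H" "a = e x"
      by (auto simp: H'_def)
    show "\<exists>b\<in>carrier H'. b \<otimes>\<^bsub>H'\<^esub> a = \<one>\<^bsub>H'\<^esub>"
      using x by (intro bexI[of _ "e (inv\<^bsub>H\<^esub> x)"]) (auto simp: H'_def ke)
  qed (auto simp: H'_def ke H.m_ac)
  then interpret H': comm_group H' .
  have iso: "e \<in> iso H H'"
    using e by (auto simp: iso_def hom_def bij_betw_def H'_def ke)
  interpret eh: group_hom H H' e
    using iso by (unfold_locales) (auto simp: iso_def)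
  obtain g where g: "homeomorphic_maps T T' e g"
    using T' homeomorphic_map_maps by blast
  have ce: "continuous_map T T' e" and cg: "continuous_map T' T g"
    using g by (auto simp: homeomorphic_maps_def)
  have eg: "g y \<in> carrier H" "e (g y) = y" if "y \<in> carrier H'" for y
    using g that tT tT' by (auto simp: homeomorphic_maps_def continuous_map_def)
  have hs: "T homeomorphic_space T'"
    using T' homeomorphic_map_imp_homeomorphic_space by blast
  have cm: "continuous_map (prod_topology T T) T (\<lambda>(x, y). x \<otimes>\<^bsub>H\<^esub> y)"
    and ci: "continuous_map T T (\<lambda>x. inv\<^bsub>H\<^esub> x)"
    using H by (auto simp: lca_group_def)
  have "continuous_map (prod_topology T' T') (prod_topology T T) (\<lambda>(x, y). (g x, g y))"
    using cg by (simp add: continuous_map_prod_top)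
  from continuous_map_compose[OF continuous_map_compose[OF this cm] ce]
  have "continuous_map (prod_topology T' T') T'
      (e \<circ> ((\<lambda>(x, y). x \<otimes>\<^bsub>H\<^esub> y) \<circ> (\<lambda>(x, y). (g x, g y))))"
    .
  then have "continuous_map (prod_topology T' T') T' (\<lambda>(x, y). x \<otimes>\<^bsub>H'\<^esub> y)"
    by (rule continuous_map_eq) (use eg in \<open>auto simp: tT'\<close>)
  moreover have "continuous_map T' T' (e \<circ> ((\<lambda>x. inv\<^bsub>H\<^esub> x) \<circ> g))"
    by (intro continuous_map_compose[OF continuous_map_compose[OF cg ci] ce])
  then have "continuous_map T' T' (\<lambda>x. inv\<^bsub>H'\<^esub> x)"
    by (rule continuous_map_eq) (use eg in \<open>auto simp: tT'\<close>)
  moreover have "Hausdorff_space T'" "locally_compact_space T'"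
    using H hs homeomorphic_Hausdorff_space homeomorphic_locally_compact_space
    by (auto simp: lca_group_def)
  ultimately have "lca_group H' T'"
    using comm tT' by (simp add: lca_group_def)
  then show thesis
    using that iso T' by blast
qed

lemma model_setI:
  fixes H :: "('h, 'b) monoid_scheme" and T :: "'h topology" and Lt :: "((real^'d) \<times> 'h) set"
  assumes cps: "cut_and_project_scheme H T Lt" and win: "window T \<Omega>"
    and A: "A = (+) t ` projected_set Lt \<Omega>"
  shows "model_set A"
proof -
  have lca: "lca_group H T" and inj: "inj_on fst Lt"
    and dense: "T closure_of (snd ` Lt) = topspace T"
    and lat: "cocompact_lattice (euclidean_group \<times>\<times> H) (prod_topology euclidean T) Lt"
    using cps by (auto simp: cut_and_project_scheme_def)
  have H: "group H" and tT: "topspace T = carrier H" and "Hausdorff_space T"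
    using lca by (auto simp: lca_group_def comm_group_def)
  obtain e :: "'h \<Rightarrow> (real^'d) set set" where e: "inj_on e (carrier H)"
    using Hausdorff_dense_embedding[OF \<open>Hausdorff_space T\<close> dense inj] tT by metis
  obtain H' :: "(real^'d) set set monoid" and T' where H': "lca_group H' T'" "e \<in> iso H H'" and T': "homeomorphic_map T T' e"
    using lca_group_transport[OF lca e] by metis
  have gH': "group H'"
    using H' by (auto simp: lca_group_def comm_group_def)
  define h where "h = (\<lambda>(x :: real^'d, y). (x, e y))"
  have "h \<in> iso (euclidean_group \<times>\<times> H) (euclidean_group \<times>\<times> H')"
  proof (rule isoI)
    have e: "e \<in> hom H H'" "bij_betw e (carrier H) (carrier H')"
      using H'(2) by (auto simp: iso_def)
    show "h \<in> hom (euclidean_group \<times>\<times> H) (euclidean_group \<times>\<times> H')"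
      using e(1) by (auto simp: hom_def h_def euclidean_group_def)
    have "h = map_prod id e"
      by (auto simp: h_def)
    then show "bij_betw h (carrier (euclidean_group \<times>\<times> H)) (carrier (euclidean_group \<times>\<times> H'))"
      using bij_betw_map_prod[OF bij_betw_id e(2)] by (simp add: euclidean_group_def)
  qed
  moreover have "homeomorphic_map (prod_topology euclidean T) (prod_topology euclidean T') h"
  proof -
    obtain g where g: "homeomorphic_maps T T' e g"
      using T' homeomorphic_map_maps by blast
    have "homeomorphic_maps (prod_topology euclidean T) (prod_topology euclidean T')
        (\<lambda>(x, y). (id x, e y)) (\<lambda>(x :: real^'d, y). (id x, g y))"
      using g homeomorphic_maps_id by (subst homeomorphic_maps_prod) auto
    then show ?thesis
      using homeomorphic_maps_imp_map by (simp add: h_def homeomorphic_maps_map)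
  qed
  moreover have "topspace (prod_topology euclidean T) = carrier (euclidean_group \<times>\<times> H)"
    by (simp add: tT euclidean_group_def)
  ultimately have lat': "cocompact_lattice (euclidean_group \<times>\<times> H') (prod_topology euclidean T') (h ` Lt)"
    using lat H gH' group_euclidean_group by (intro cocompact_lattice_transport) (auto intro: DirProd_group)
  have sub: "Lt \<subseteq> UNIV \<times> carrier H"
    using lat subgroup.subset by (fastforce simp: cocompact_lattice_def)
  have fst_h: "fst (h z) = fst z" and snd_h: "snd (h z) = e (snd z)" for z
    by (simp_all add: h_def case_prod_beta)
  have "inj_on fst (h ` Lt)"
  proof (rule inj_onI)
    fix a b assume "a \<in> h ` Lt" "b \<in> h ` Lt" "fst a = fst b"
    then obtain z w where zw: "z \<in> Lt" "w \<in> Lt" "a = h z" "b = h w"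
      by blast
    with \<open>fst a = fst b\<close> have "fst z = fst w"
      by (simp add: fst_h)
    then have "z = w"
      using inj zw by (simp add: inj_on_eq_iff)
    then show "a = b"
      using zw by simp
  qed
  moreover have "T' closure_of (snd ` (h ` Lt)) = topspace T'"
  proof -
    have "snd ` (h ` Lt) = e ` (snd ` Lt)"
      by (simp add: image_image snd_h)
    moreover have "snd ` Lt \<subseteq> topspace T"
      using sub tT by auto
    ultimately show ?thesis
      using homeomorphic_map_closure_of[OF T'] dense homeomorphic_imp_surjective_map[OF T'] by simp
  qed
  ultimately have cps': "cut_and_project_scheme H' T' (h ` Lt)"
    using H'(1) lat' by (simp add: cut_and_project_scheme_def)
  have \<Omega>: "\<Omega> \<subseteq> topspace T"
    using win by (simp add: window_def)
  have e\<Omega>: "e ` \<Omega> \<subseteq> topspace T'"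
    using \<Omega> homeomorphic_imp_surjective_map[OF T'] by blast
  have win': "window T' (e ` \<Omega>)"
    using e\<Omega> win \<Omega> homeomorphic_map_closure_of[OF T' \<Omega>] homeomorphic_map_interior_of[OF T' \<Omega>]
      homeomorphic_map_compactness[OF T' closure_of_subset_topspace]
      homeomorphic_imp_surjective_map[OF T']
    by (simp add: window_def)
  have "snd (h z) \<in> e ` \<Omega> \<longleftrightarrow> snd z \<in> \<Omega>" if "z \<in> Lt" for z
  proof -
    have "snd z \<in> carrier H"
      using that sub by auto
    then show ?thesis
      using inj_on_image_mem_iff[OF e] \<Omega> tT by (simp add: snd_h)
  qed
  then have "{z \<in> h ` Lt. snd z \<in> e ` \<Omega>} = h ` {z \<in> Lt. snd z \<in> \<Omega>}"
    by blast
  then have "projected_set (h ` Lt) (e ` \<Omega>) = projected_set Lt \<Omega>"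
    by (simp add: projected_set_def image_image fst_h)
  then show ?thesis
    unfolding model_set_def using A cps' win' by blast
qed

end

theory Submission
  imports Defs
begin

text \<open>
  Write \<open>L\<close> for the lattice that supports both vectors of sets. A cluster of positive radius
  determines the type of its centre, so each \<open>V i\<close> is a union of some of the sets \<open>V' j\<close>. By
  primitivity \<open>V i\<close> is nonempty, hence it contains at least one \<open>V' j\<close>. The theorem is
  therefore a consequence of a fact about model sets alone
  (\<open>model_set_mono_in_lattice\<close>): every set between a model set and a lattice \<open>L\<close> that contains
  it is a model set.

  The point is that a window is only required to have an interior point and compact closure. Such
  a window can always be enlarged, as long as the points to be added can be lifted to the scheme
  at hand and stay in a compact part of the internal group. Both obstacles disappear if the
  scheme of the given model set is replaced by one whose internal group is compact and whose
  lattice projects onto all of \<open>L\<close> (\<open>model_set_of_compact_group\<close>): any injective homomorphism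
  from \<open>L\<close> to a compact group provides one, namely its graph. What remains is to choose the
  homomorphism so that an open set of the compact group selects only points of the given model
  set, up to translation.

  The torus \<open>(R\<^sup>d \<times> H) / \<Lambda>\<close> of the original scheme achieves this. A point of \<open>L\<close> whose image
  in the torus is close to the identity differs by a short vector from a point that the original
  scheme selects, and this short vector vanishes because it is the difference of two points
  of \<open>L\<close>. The map to the torus kills the periods in \<open>L\<close> of the original scheme; adding the
  torus \<open>R\<^sup>d / \<alpha> L\<close> with irrational \<open>\<alpha>\<close> as a second factor makes it injective
  (\<open>lattice_injects_into_compact_group\<close>).
\<close>

section \<open>Locally compact Abelian groups\<close>

lemma lca_group_dest:
  assumes "lca_group G X"
  shows "comm_group G" "topspace X = carrier G" "Hausdorff_space X" "locally_compact_space X"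
  using assms by (auto simp: lca_group_def)

lemma lca_group_continuous_mult:
  assumes "lca_group G X" "continuous_map Z X f" "continuous_map Z X g"
  shows "continuous_map Z X (\<lambda>z. f z \<otimes>\<^bsub>G\<^esub> g z)"
proof -
  have "continuous_map Z X ((\<lambda>(x, y). x \<otimes>\<^bsub>G\<^esub> y) \<circ> (\<lambda>z. (f z, g z)))"
    using assms by (intro continuous_map_compose[of _ "prod_topology X X"])
      (auto simp: lca_group_def continuous_map_paired)
  then show ?thesis
    by (simp add: o_def)
qed

lemma lca_group_continuous_inv:
  assumes "lca_group G X" "continuous_map Z X f"
  shows "continuous_map Z X (\<lambda>z. inv\<^bsub>G\<^esub> f z)"
  using continuous_map_compose[OF assms(2), of X "\<lambda>x. inv\<^bsub>G\<^esub> x"] assms(1)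
  by (simp add: lca_group_def o_def)

lemma lca_group_euclidean: "lca_group (euclidean_group :: (real^'d) monoid) euclidean"
proof -
  interpret G: group "euclidean_group :: (real^'d) monoid"
    by (rule group_euclidean_group)
  have comm: "comm_group (euclidean_group :: (real^'d) monoid)"
    by (rule G.group_comm_groupI) (auto simp: euclidean_group_def)
  have "inv\<^bsub>euclidean_group\<^esub> x = - x" for x :: "real^'d"
    by (rule G.inv_equality) (auto simp: euclidean_group_def)
  then have "continuous_map euclidean euclidean (\<lambda>x :: real^'d. inv\<^bsub>euclidean_group\<^esub> x)"
    by (simp add: continuous_intros)
  moreover have "continuous_on UNIV (\<lambda>(x :: real^'d, y). x + y)"
    by (auto simp: case_prod_beta intro!: continuous_intros)
  ultimately show ?thesis
    using comm by (simp add: lca_group_def locally_compact_space_euclidean euclidean_group_def)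
qed

lemma lca_group_DirProd:
  assumes G: "lca_group G X" and H: "lca_group H T"
  shows "lca_group (G \<times>\<times> H) (prod_topology X T)"
proof -
  interpret G: comm_group G using lca_group_dest[OF G] by simp
  interpret H: comm_group H using lca_group_dest[OF H] by simp
  interpret P: group "G \<times>\<times> H" by (simp add: DirProd_group G.is_group H.is_group)
  let ?P = "prod_topology X T"
  note t = lca_group_dest(2)[OF G] lca_group_dest(2)[OF H]
  have "comm_group (G \<times>\<times> H)"
    by (rule P.group_comm_groupI) (auto simp: G.m_comm H.m_comm)
  moreover have "continuous_map (prod_topology ?P ?P) ?P
      (\<lambda>p. (fst (fst p) \<otimes>\<^bsub>G\<^esub> fst (snd p), snd (fst p) \<otimes>\<^bsub>H\<^esub> snd (snd p)))"
    using G H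
    by (intro continuous_map_pairedI lca_group_continuous_mult
        continuous_map_compose[OF continuous_map_fst continuous_map_fst, unfolded o_def]
        continuous_map_compose[OF continuous_map_snd continuous_map_fst, unfolded o_def]
        continuous_map_compose[OF continuous_map_fst continuous_map_snd, unfolded o_def]
        continuous_map_compose[OF continuous_map_snd continuous_map_snd, unfolded o_def])
  then have "continuous_map (prod_topology ?P ?P) ?P (\<lambda>(x, y). x \<otimes>\<^bsub>G \<times>\<times> H\<^esub> y)"
    by (simp add: case_prod_unfold mult_DirProd')
  moreover have "continuous_map ?P ?P (\<lambda>p. (inv\<^bsub>G\<^esub> fst p, inv\<^bsub>H\<^esub> snd p))"
    using G H by (intro continuous_map_pairedI lca_group_continuous_inv continuous_intros)
  then have "continuous_map ?P ?P (\<lambda>p. inv\<^bsub>G \<times>\<times> H\<^esub> p)"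
    by (rule continuous_map_eq) (auto simp: t)
  ultimately show ?thesis
    using lca_group_dest[OF G] lca_group_dest[OF H]
    by (simp add: lca_group_def Hausdorff_space_prod_topology locally_compact_space_prod_topology)
qed

text \<open>
  Near any point \<open>g\<close> there is a set \<open>N\<close> so small that all quotients of its elements lie in a
  neighbourhood of \<open>1\<close> meeting the subgroup in \<open>1\<close> only. Such an \<open>N\<close> contains at most one element
  of the subgroup, which can be removed from \<open>N\<close> if it differs from \<open>g\<close>.
\<close>

lemma closedin_discrete_subgroup:
  assumes G: "lca_group G X" and sub: "subgroup \<Lambda> G"
    and disc: "subtopology X \<Lambda> = discrete_topology \<Lambda>"
  shows "closedin X \<Lambda>"
proof -
  interpret comm_group G using lca_group_dest[OF G] by simp
  interpret S: subgroup \<Lambda> G by (rule sub)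
  note t = lca_group_dest(2)[OF G]
  have "openin (subtopology X \<Lambda>) {\<one>\<^bsub>G\<^esub>}"
    by (simp add: disc)
  then obtain U where U: "openin X U" "U \<inter> \<Lambda> = {\<one>\<^bsub>G\<^esub>}"
    by (auto simp: openin_subtopology)
  have "X closure_of \<Lambda> \<subseteq> \<Lambda>"
  proof
    fix g assume g: "g \<in> X closure_of \<Lambda>"
    then have gc: "g \<in> carrier G"
      using closure_of_subset_topspace[of X \<Lambda>] t by blast
    let ?D = "{p \<in> topspace (prod_topology X X). fst p \<otimes>\<^bsub>G\<^esub> inv\<^bsub>G\<^esub> snd p \<in> U}"
    have "openin (prod_topology X X) ?D"
      using U G by (intro openin_continuous_map_preimage[of _ X] lca_group_continuous_mult
          lca_group_continuous_inv continuous_intros) auto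
    moreover have "(g, g) \<in> ?D"
      using gc U by (auto simp: t)
    ultimately obtain A B where AB: "openin X A" "openin X B" "g \<in> A" "g \<in> B" "A \<times> B \<subseteq> ?D"
      by (blast dest: openin_prod_topology_alt[THEN iffD1, rule_format])
    obtain l where l: "l \<in> \<Lambda>" "l \<in> A \<inter> B"
      using g AB unfolding in_closure_of by (metis IntI openin_Int)
    show "g \<in> \<Lambda>"
    proof (rule ccontr)
      assume "g \<notin> \<Lambda>"
      then have "g \<in> A \<inter> B - {l}" using l AB by auto
      moreover have "openin X (A \<inter> B - {l})"
        using AB lca_group_dest(3)[OF G] l t
        by (intro openin_diff openin_Int closedin_Hausdorff_singleton) auto
      ultimately obtain k where k: "k \<in> \<Lambda>" "k \<in> A \<inter> B - {l}"
        using g unfolding in_closure_of by metis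
      have "(k, l) \<in> ?D" using k l AB by blast
      then have "k \<otimes>\<^bsub>G\<^esub> inv\<^bsub>G\<^esub> l \<in> U \<inter> \<Lambda>"
        using k l by simp
      then have "k \<otimes>\<^bsub>G\<^esub> inv\<^bsub>G\<^esub> l = \<one>\<^bsub>G\<^esub>" using U by simp
      then have "k = l"
        using k l by (metis S.mem_carrier inv_closed inv_equality inv_inv)
      then show False using k by simp
    qed
  qed
  then show ?thesis
    using closure_of_subset_eq[of \<Lambda> X] S.subset t by simp
qed

lemma r_coset_eq_iff:
  assumes "comm_group G" "subgroup \<Lambda> G" "x \<in> carrier G" "y \<in> carrier G"
  shows "\<Lambda> #>\<^bsub>G\<^esub> x = \<Lambda> #>\<^bsub>G\<^esub> y \<longleftrightarrow> x \<otimes>\<^bsub>G\<^esub> inv\<^bsub>G\<^esub> y \<in> \<Lambda>"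
proof -
  interpret comm_group G by fact
  interpret S: subgroup \<Lambda> G by fact
  have "x \<in> \<Lambda> #>\<^bsub>G\<^esub> y \<longleftrightarrow> x \<otimes>\<^bsub>G\<^esub> inv\<^bsub>G\<^esub> y \<in> \<Lambda>"
    using S.rcos_module[OF is_group] assms by blast
  then show ?thesis
    using repr_independence[of x \<Lambda> y] repr_independenceD[of \<Lambda> x y] assms by metis
qed

text \<open>
  The saturation of an open set \<open>U\<close> is the union of the translates of \<open>U\<close> by the subgroup.
\<close>

lemma quotient_group_open_map:
  assumes G: "lca_group G X" and sub: "subgroup \<Lambda> G"
    and Y: "quotient_map X Y (\<lambda>x. \<Lambda> #>\<^bsub>G\<^esub> x)"
  shows "open_map X Y (\<lambda>x. \<Lambda> #>\<^bsub>G\<^esub> x)"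
  unfolding open_map_def
proof (intro allI impI)
  fix U assume U: "openin X U"
  interpret comm_group G using lca_group_dest[OF G] by simp
  interpret S: subgroup \<Lambda> G by (rule sub)
  note t = lca_group_dest(2)[OF G]
  let ?p = "\<lambda>x. \<Lambda> #>\<^bsub>G\<^esub> x"
  have Uc: "U \<subseteq> carrier G" using U t openin_subset by metis
  have "{x \<in> topspace X. ?p x \<in> ?p ` U} = (\<Union>l\<in>\<Lambda>. {x \<in> topspace X. l \<otimes>\<^bsub>G\<^esub> x \<in> U})"
  proof (intro equalityI subsetI)
    fix x assume "x \<in> {x \<in> topspace X. ?p x \<in> ?p ` U}"
    then obtain u where u: "x \<in> carrier G" "u \<in> U" "?p x = ?p u"
      by (auto simp: t)
    then have "u \<in> ?p x"
      using rcos_self[OF _ sub, of u] Uc by auto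
    then obtain l where "l \<in> \<Lambda>" "u = l \<otimes>\<^bsub>G\<^esub> x"
      by (auto simp: r_coset_def)
    then show "x \<in> (\<Union>l\<in>\<Lambda>. {x \<in> topspace X. l \<otimes>\<^bsub>G\<^esub> x \<in> U})"
      using u t by auto
  next
    fix x assume "x \<in> (\<Union>l\<in>\<Lambda>. {x \<in> topspace X. l \<otimes>\<^bsub>G\<^esub> x \<in> U})"
    then obtain l where l: "l \<in> \<Lambda>" "x \<in> carrier G" "l \<otimes>\<^bsub>G\<^esub> x \<in> U"
      by (auto simp: t)
    then have "?p x = ?p (l \<otimes>\<^bsub>G\<^esub> x)"
      using repr_independence[OF _ _ sub, of "l \<otimes>\<^bsub>G\<^esub> x" x] by (auto simp: r_coset_def)
    then show "x \<in> {x \<in> topspace X. ?p x \<in> ?p ` U}"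
      using l t by auto
  qed
  moreover have "openin X (\<Union>l\<in>\<Lambda>. {x \<in> topspace X. l \<otimes>\<^bsub>G\<^esub> x \<in> U})"
  proof (intro openin_Union ballI)
    fix W assume "W \<in> (\<lambda>l. {x \<in> topspace X. l \<otimes>\<^bsub>G\<^esub> x \<in> U}) ` \<Lambda>"
    then obtain l where l: "l \<in> \<Lambda>" "W = {x \<in> topspace X. l \<otimes>\<^bsub>G\<^esub> x \<in> U}"
      by blast
    have "continuous_map X X (\<lambda>x. l \<otimes>\<^bsub>G\<^esub> x)"
      using l t by (intro lca_group_continuous_mult[OF G]) auto
    then show "openin X W"
      using U unfolding l by (rule openin_continuous_map_preimage)
  qed
  moreover have "?p ` U \<subseteq> topspace Y"
    using quotient_imp_surjective_map[OF Y] Uc t by auto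
  ultimately show "openin Y (?p ` U)"
    using Y unfolding quotient_map_def by metis
qed

lemma open_map_prod:
  assumes "open_map X Y f" "open_map X' Y' g"
  shows "open_map (prod_topology X X') (prod_topology Y Y') (\<lambda>(x, y). (f x, g y))"
  unfolding open_map_def
proof (intro allI impI)
  fix U assume U: "openin (prod_topology X X') U"
  show "openin (prod_topology Y Y') ((\<lambda>(x, y). (f x, g y)) ` U)"
    unfolding openin_prod_topology_alt
  proof (intro allI impI)
    fix a b assume "(a, b) \<in> (\<lambda>(x, y). (f x, g y)) ` U"
    then obtain x y where xy: "(x, y) \<in> U" "a = f x" "b = g y" by auto
    then obtain A B where AB: "openin X A" "openin X' B" "x \<in> A" "y \<in> B" "A \<times> B \<subseteq> U"
      using U by (metis openin_prod_topology_alt)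
    show "\<exists>A B. openin Y A \<and> openin Y' B \<and> a \<in> A \<and> b \<in> B \<and> A \<times> B \<subseteq> (\<lambda>(x, y). (f x, g y)) ` U"
    proof (intro exI conjI)
      show "openin Y (f ` A)" "openin Y' (g ` B)"
        using assms AB by (auto simp: open_map_def)
      show "f ` A \<times> g ` B \<subseteq> (\<lambda>(x, y). (f x, g y)) ` U"
        using AB by force
    qed (use AB xy in auto)
  qed
qed

text \<open>
  Two distinct cosets are separated because the subgroup is closed: the condition that
  \<open>x \<otimes> inv y\<close> avoid the subgroup is open in \<open>(x, y)\<close>, so it holds on a box \<open>A \<times> B\<close>, whose
  sides have disjoint open images. The group operations are continuous because the quotient
  map is open, which makes its square a quotient map as well.
\<close>

lemma lca_group_quotient:
  assumes G: "lca_group G X" and sub: "subgroup \<Lambda> G"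
    and disc: "subtopology X \<Lambda> = discrete_topology \<Lambda>"
    and Y: "quotient_map X Y (\<lambda>x. \<Lambda> #>\<^bsub>G\<^esub> x)" and cpt: "compact_space Y"
  shows "lca_group (G Mod \<Lambda>) Y"
proof -
  interpret comm_group G using lca_group_dest[OF G] by simp
  interpret S: subgroup \<Lambda> G by (rule sub)
  interpret N: normal \<Lambda> G by (rule subgroup_imp_normal[OF sub])
  note t = lca_group_dest(2)[OF G]
  define p where "p = (\<lambda>x. \<Lambda> #>\<^bsub>G\<^esub> x)"
  have Y: "quotient_map X Y p" using Y by (simp add: p_def)
  have op: "open_map X Y p"
    unfolding p_def using quotient_group_open_map[OF G sub] Y p_def by simp
  have cp: "continuous_map X Y p" using Y quotient_imp_continuous_map by blast
  have surj: "p ` carrier G = topspace Y" using quotient_imp_surjective_map[OF Y] t by simp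
  have car: "topspace Y = carrier (G Mod \<Lambda>)"
    using surj by (simp add: carrier_FactGroup p_def)
  have cG: "comm_group (G Mod \<Lambda>)" by (rule abelian_FactGroup[OF sub])
  have "Hausdorff_space Y"
    unfolding Hausdorff_space_def
  proof (intro allI impI)
    fix a b assume ab: "a \<in> topspace Y \<and> b \<in> topspace Y \<and> a \<noteq> b"
    then obtain x y where xy: "x \<in> carrier G" "y \<in> carrier G" "a = p x" "b = p y"
      by (auto simp: surj[symmetric])
    let ?D = "{q \<in> topspace (prod_topology X X). fst q \<otimes>\<^bsub>G\<^esub> inv\<^bsub>G\<^esub> snd q \<in> topspace X - \<Lambda>}"
    have "openin (prod_topology X X) ?D"
      using closedin_discrete_subgroup[OF G sub disc] G
      by (intro openin_continuous_map_preimage[of _ X] lca_group_continuous_mult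
          lca_group_continuous_inv continuous_intros) auto
    moreover have "(x, y) \<in> ?D"
      using xy ab r_coset_eq_iff[OF comm_group_axioms sub] by (auto simp: t p_def)
    ultimately obtain A B where AB: "openin X A" "openin X B" "x \<in> A" "y \<in> B" "A \<times> B \<subseteq> ?D"
      by (blast dest: openin_prod_topology_alt[THEN iffD1, rule_format])
    have "A \<subseteq> carrier G" "B \<subseteq> carrier G" using AB openin_subset t by metis+
    moreover have "p x' \<noteq> p y'" if "x' \<in> A" "y' \<in> B" "x' \<in> carrier G" "y' \<in> carrier G" for x' y'
      using that AB(5) r_coset_eq_iff[OF comm_group_axioms sub that(3,4)] by (auto simp: p_def)
    ultimately have "disjnt (p ` A) (p ` B)"
      unfolding disjnt_iff by blast
    then show "\<exists>U V. openin Y U \<and> openin Y V \<and> a \<in> U \<and> b \<in> V \<and> disjnt U V"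
      using op AB xy unfolding open_map_def by blast
  qed
  moreover have "continuous_map (prod_topology Y Y) Y (\<lambda>(x, y). x \<otimes>\<^bsub>G Mod \<Lambda>\<^esub> y)"
  proof (rule continuous_compose_quotient_map)
    show "quotient_map (prod_topology X X) (prod_topology Y Y) (\<lambda>(x, y). (p x, p y))"
    proof (rule continuous_open_imp_quotient_map)
      show "continuous_map (prod_topology X X) (prod_topology Y Y) (\<lambda>(x, y). (p x, p y))"
        using cp by (simp add: continuous_map_prod_top)
      show "(\<lambda>(x, y). (p x, p y)) ` topspace (prod_topology X X) = topspace (prod_topology Y Y)"
        by (force simp: surj[symmetric] t)
    qed (rule open_map_prod[OF op op])
    have "continuous_map (prod_topology X X) Y (p \<circ> (\<lambda>(x, y). x \<otimes>\<^bsub>G\<^esub> y))"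
      using G cp by (intro continuous_map_compose[of _ X]) (auto simp: lca_group_def)
    then show "continuous_map (prod_topology X X) Y
        ((\<lambda>(x, y). x \<otimes>\<^bsub>G Mod \<Lambda>\<^esub> y) \<circ> (\<lambda>(x, y). (p x, p y)))"
      by (rule continuous_map_eq) (auto simp: t p_def N.rcos_sum)
  qed
  moreover have "continuous_map Y Y (\<lambda>x. inv\<^bsub>G Mod \<Lambda>\<^esub> x)"
  proof (rule continuous_compose_quotient_map[OF Y])
    have "continuous_map X Y (p \<circ> (\<lambda>x. inv\<^bsub>G\<^esub> x))"
      using G cp by (intro continuous_map_compose[of _ X]) (auto simp: lca_group_def)
    then show "continuous_map X Y ((\<lambda>x. inv\<^bsub>G Mod \<Lambda>\<^esub> x) \<circ> p)"
    proof (rule continuous_map_eq)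
      fix x assume "x \<in> topspace X"
      then have x: "x \<in> carrier G" using t by simp
      then have "p x \<in> carrier (G Mod \<Lambda>)" using car surj by auto
      then show "(p \<circ> (\<lambda>x. inv\<^bsub>G\<^esub> x)) x = ((\<lambda>x. inv\<^bsub>G Mod \<Lambda>\<^esub> x) \<circ> p) x"
        using x by (simp add: N.inv_FactGroup p_def N.rcos_inv)
    qed
  qed
  moreover have "locally_compact_space Y"
    using cpt by (rule compact_imp_locally_compact_space)
  ultimately show ?thesis
    using cG car by (simp add: lca_group_def)
qed

text \<open>
  Density arguments: the product of a closure point and a subgroup element is a closure point
  by continuity in the first factor, and commutativity exchanges the factors for a second
  passage to the limit.
\<close>

lemma subgroup_closure_of:
  assumes K: "lca_group K T" and S: "subgroup S K"
  shows "subgroup (T closure_of S) K"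
proof -
  interpret comm_group K using lca_group_dest[OF K] by simp
  interpret S: subgroup S K by (rule S)
  note t = lca_group_dest(2)[OF K]
  let ?C = "T closure_of S"
  have C: "?C \<subseteq> carrier K" using closure_of_subset_topspace t by metis
  have SC: "S \<subseteq> ?C" using closure_of_subset S.subset t by metis
  have pre: "closedin T {x \<in> topspace T. x \<otimes>\<^bsub>K\<^esub> y \<in> ?C}" if "y \<in> carrier K" for y
    using that K t by (intro closedin_continuous_map_preimage[of _ T] lca_group_continuous_mult)
      (auto simp: t)
  have 1: "x \<otimes>\<^bsub>K\<^esub> y \<in> ?C" if "x \<in> ?C" "y \<in> S" for x y
    using that(1) by (rule forall_in_closure_of) (use that SC pre S.subset in auto)
  have 2: "x \<otimes>\<^bsub>K\<^esub> y \<in> ?C" if "x \<in> ?C" "y \<in> ?C" for x y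
    using that(1)
  proof (rule forall_in_closure_of)
    fix x assume x: "x \<in> S"
    have "y \<otimes>\<^bsub>K\<^esub> x \<in> ?C" using 1 x that by blast
    then show "x \<otimes>\<^bsub>K\<^esub> y \<in> ?C"
      using m_comm x that C by (metis S.mem_carrier subsetD)
  qed (use pre that C in auto)
  have 3: "inv\<^bsub>K\<^esub> x \<in> ?C" if "x \<in> ?C" for x
    using that
  proof (rule forall_in_closure_of)
    show "closedin T {x \<in> topspace T. inv\<^bsub>K\<^esub> x \<in> ?C}"
      using K by (intro closedin_continuous_map_preimage[of _ T] lca_group_continuous_inv) auto
  qed (use SC in auto)
  have "?C \<noteq> {}" using SC S.one_closed by blast
  then show ?thesis
    using C 2 3 by (intro subgroupI) auto
qed

lemma lca_group_closed_subgroup: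
  assumes K: "lca_group K T" and S: "subgroup C K" and C: "closedin T C"
  shows "lca_group (K\<lparr>carrier := C\<rparr>) (subtopology T C)"
proof -
  interpret comm_group K using lca_group_dest[OF K] by simp
  interpret S: subgroup C K by (rule S)
  note t = lca_group_dest(2)[OF K]
  have comm: "comm_group (K\<lparr>carrier := C\<rparr>)"
    by (rule group.group_comm_groupI[OF subgroup_imp_group[OF S]]) (auto simp: m_comm)
  have inv: "inv\<^bsub>K\<lparr>carrier := C\<rparr>\<^esub> x = inv\<^bsub>K\<^esub> x" if "x \<in> C" for x
    using m_inv_consistent[OF S that] .
  let ?T = "subtopology T C"
  have "continuous_map (prod_topology ?T ?T) ?T (\<lambda>(x, y). x \<otimes>\<^bsub>K\<^esub> y)"
  proof (rule continuous_map_into_subtopology)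
    have "continuous_map (subtopology (prod_topology T T) (C \<times> C)) T (\<lambda>(x, y). x \<otimes>\<^bsub>K\<^esub> y)"
      using K by (intro continuous_map_from_subtopology) (simp add: lca_group_def)
    then show "continuous_map (prod_topology ?T ?T) T (\<lambda>(x, y). x \<otimes>\<^bsub>K\<^esub> y)"
      by (simp add: subtopology_Times)
  qed auto
  moreover have "continuous_map ?T ?T (\<lambda>x. inv\<^bsub>K\<^esub> x)"
    using K by (intro continuous_map_into_subtopology continuous_map_from_subtopology)
      (auto simp: lca_group_def)
  then have "continuous_map ?T ?T (\<lambda>x. inv\<^bsub>K\<lparr>carrier := C\<rparr>\<^esub> x)"
    by (rule continuous_map_eq) (simp add: inv)
  moreover have "locally_compact_space ?T"
    using lca_group_dest(4)[OF K] C locally_compact_space_closed_subset by blast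
  ultimately show ?thesis
    using comm lca_group_dest[OF K] S.subset
    by (auto simp: lca_group_def Hausdorff_space_subtopology)
qed

section \<open>Lattices\<close>

text \<open>
  This is the final topology with respect to \<open>f\<close>.
\<close>

lemma quotient_map_exists:
  obtains Y where "quotient_map X Y f"
proof -
  define P where "P U \<longleftrightarrow> U \<subseteq> f ` topspace X \<and> openin X {x \<in> topspace X. f x \<in> U}" for U
  have "istopology P"
    unfolding istopology_def
  proof (intro conjI allI impI)
    fix S T assume "P S" "P T"
    then have "openin X ({x \<in> topspace X. f x \<in> S} \<inter> {x \<in> topspace X. f x \<in> T})"
      by (auto simp: P_def)
    moreover have "{x \<in> topspace X. f x \<in> S} \<inter> {x \<in> topspace X. f x \<in> T}
        = {x \<in> topspace X. f x \<in> S \<inter> T}" by auto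
    ultimately show "P (S \<inter> T)"
      using \<open>P S\<close> by (auto simp: P_def)
  next
    fix \<U> assume *: "\<forall>U\<in>\<U>. P U"
    then have "openin X (\<Union>U\<in>\<U>. {x \<in> topspace X. f x \<in> U})"
      by (auto simp: P_def)
    moreover have "(\<Union>U\<in>\<U>. {x \<in> topspace X. f x \<in> U}) = {x \<in> topspace X. f x \<in> \<Union>\<U>}" by auto
    ultimately show "P (\<Union>\<U>)"
      using * by (auto simp: P_def)
  qed
  then have op: "openin (topology P) = P"
    by (simp add: topology_inverse')
  have "{x \<in> topspace X. f x \<in> f ` topspace X} = topspace X" by auto
  then have "P (f ` topspace X)"
    by (simp add: P_def)
  have top: "topspace (topology P) = f ` topspace X"
  proof
    show "topspace (topology P) \<subseteq> f ` topspace X"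
      using openin_topspace[of "topology P"] unfolding op P_def by simp
    show "f ` topspace X \<subseteq> topspace (topology P)"
      using \<open>P (f ` topspace X)\<close> by (intro openin_subset) (simp add: op)
  qed
  have "quotient_map X (topology P) f"
    unfolding quotient_map_def by (auto simp: op top P_def)
  then show thesis by (rule that)
qed

lemma lattice_basis_coordinates:
  fixes u :: "'d::finite \<Rightarrow> real^'d"
  assumes "lattice_basis u L"
  obtains g :: "real^'d \<Rightarrow> real^'d" where "linear g" "\<And>x. (\<Sum>k\<in>UNIV. (g x $ k) *\<^sub>R u k) = x"
    "\<And>x. x \<in> L \<longleftrightarrow> (\<forall>k. g x $ k \<in> \<int>)"
proof -
  have inj: "inj u" and ind: "independent (range u)"
    and L: "L = {(\<Sum>i\<in>UNIV. of_int (c i) *\<^sub>R u i) |c::'d \<Rightarrow> int. True}"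
    using assms by (auto simp: lattice_basis_def)
  obtain g where g: "linear g" "\<forall>x\<in>range u. g x = axis (inv_into UNIV u x) (1::real)"
    using linear_independent_extend[OF ind, of "\<lambda>x. axis (inv_into UNIV u x) 1"] by blast
  have gu: "g (u k) = axis k 1" for k
    using g inj by simp
  define h :: "real^'d \<Rightarrow> real^'d" where "h y = (\<Sum>k\<in>UNIV. (y $ k) *\<^sub>R u k)" for y
  have "linear h"
    by (rule linearI) (simp_all add: h_def sum.distrib scaleR_left_distrib scaleR_sum_right)
  have gsum: "g (\<Sum>k\<in>UNIV. c k *\<^sub>R u k) = (\<chi> k. c k)" for c
  proof -
    have "g (\<Sum>k\<in>UNIV. c k *\<^sub>R u k) = (\<Sum>k\<in>UNIV. c k *\<^sub>R axis k 1)"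
      using g(1) by (simp add: linear_sum linear_cmul gu)
    also have "\<dots> = (\<chi> k. c k)"
      by (simp add: vec_eq_iff axis_def if_distrib[of "\<lambda>x. _ * x"] cong: if_cong)
    finally show ?thesis .
  qed
  have "g \<circ> h = id"
    by (auto simp: h_def gsum fun_eq_iff)
  then have hg: "h \<circ> g = id"
    using linear_inverse_left g(1) \<open>linear h\<close> by blast
  then have rep: "(\<Sum>k\<in>UNIV. (g x $ k) *\<^sub>R u k) = x" for x
    by (simp add: h_def fun_eq_iff)
  moreover have "x \<in> L \<longleftrightarrow> (\<forall>k. g x $ k \<in> \<int>)" for x
  proof
    assume "x \<in> L"
    then obtain c :: "'d \<Rightarrow> int" where "x = (\<Sum>i\<in>UNIV. of_int (c i) *\<^sub>R u i)"
      by (auto simp: L)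
    then show "\<forall>k. g x $ k \<in> \<int>"
      by (simp add: gsum)
  next
    assume "\<forall>k. g x $ k \<in> \<int>"
    then have "\<forall>k. \<exists>c. g x $ k = of_int c"
      by (auto elim: Ints_cases)
    then obtain c :: "'d \<Rightarrow> int" where "\<And>k. g x $ k = of_int (c k)"
      by (auto dest: choice)
    then have "(\<Sum>k\<in>UNIV. (g x $ k) *\<^sub>R u k) = (\<Sum>i\<in>UNIV. of_int (c i) *\<^sub>R u i)"
      by simp
    then have "x = (\<Sum>i\<in>UNIV. of_int (c i) *\<^sub>R u i)"
      by (simp only: rep)
    then show "x \<in> L"
      unfolding L by blast
  qed
  ultimately show thesis
    using that g(1) by blast
qed

lemma lattice_basis_add_closed:
  assumes "lattice_basis u L"
  shows "0 \<in> L" "x \<in> L \<Longrightarrow> y \<in> L \<Longrightarrow> x + y \<in> L" "x \<in> L \<Longrightarrow> - x \<in> L"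
    "x \<in> L \<Longrightarrow> y \<in> L \<Longrightarrow> x - y \<in> L"
proof -
  obtain g where g: "linear g" "\<And>x. (\<Sum>k\<in>UNIV. (g x $ k) *\<^sub>R u k) = x"
    "\<And>x. x \<in> L \<longleftrightarrow> (\<forall>k. g x $ k \<in> \<int>)"
    by (rule lattice_basis_coordinates[OF assms]) (rule that)
  show "0 \<in> L" "x \<in> L \<Longrightarrow> y \<in> L \<Longrightarrow> x + y \<in> L" "x \<in> L \<Longrightarrow> - x \<in> L"
    "x \<in> L \<Longrightarrow> y \<in> L \<Longrightarrow> x - y \<in> L"
    using g(1) by (auto simp: g(3) linear_0 linear_add linear_neg linear_diff)
qed

lemma lattice_basis_separated:
  fixes u :: "'d::finite \<Rightarrow> real^'d"
  assumes "lattice_basis u L"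
  obtains e where "e > 0" "\<And>x. x \<in> L \<Longrightarrow> norm x < e \<Longrightarrow> x = 0"
proof -
  obtain g :: "real^'d \<Rightarrow> real^'d" where g: "linear g" "\<And>x. (\<Sum>k\<in>UNIV. (g x $ k) *\<^sub>R u k) = x"
    "\<And>x. x \<in> L \<longleftrightarrow> (\<forall>k. g x $ k \<in> \<int>)"
    by (rule lattice_basis_coordinates[OF assms]) (rule that)
  obtain B where B: "B > 0" "\<And>x. norm (g x) \<le> B * norm x"
    using linear_bounded_pos[OF g(1)] by blast
  have "x = 0" if "x \<in> L" "norm x < 1 / B" for x
  proof -
    have "g x $ k = 0" for k
    proof -
      have "\<bar>g x $ k\<bar> \<le> norm (g x)" by (rule component_le_norm_cart)
      also have "\<dots> \<le> B * norm x" by (rule B)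
      also have "\<dots> < 1" using that B(1) by (simp add: field_simps)
      finally show ?thesis
        using that(1) g(3) Ints_nonzero_abs_less1 by blast
    qed
    then have "(\<Sum>k\<in>UNIV. (g x $ k) *\<^sub>R u k) = 0" by simp
    then show ?thesis by (simp only: g(2))
  qed
  then show thesis using that[of "1 / B"] B(1) by simp
qed

lemma lattice_basis_decompose:
  fixes u :: "'d::finite \<Rightarrow> real^'d"
  assumes "lattice_basis u L"
  obtains F where "compact F" "\<And>x. \<exists>l\<in>L. x - l \<in> F"
proof -
  obtain g :: "real^'d \<Rightarrow> real^'d" where g: "linear g" "\<And>x. (\<Sum>k\<in>UNIV. (g x $ k) *\<^sub>R u k) = x"
    "\<And>x. x \<in> L \<longleftrightarrow> (\<forall>k. g x $ k \<in> \<int>)"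
    by (rule lattice_basis_coordinates[OF assms]) (rule that)
  have L: "L = {(\<Sum>i\<in>UNIV. of_int (c i) *\<^sub>R u i) |c::'d \<Rightarrow> int. True}"
    using assms by (auto simp: lattice_basis_def)
  define F where "F = (\<lambda>y :: real^'d. \<Sum>k\<in>UNIV. (y $ k) *\<^sub>R u k) ` cbox 0 1"
  have "compact F"
    unfolding F_def by (intro compact_continuous_image continuous_intros) auto
  moreover have "\<exists>l\<in>L. x - l \<in> F" for x
  proof
    let ?l = "\<Sum>k\<in>UNIV. of_int \<lfloor>g x $ k\<rfloor> *\<^sub>R u k"
    show "?l \<in> L" by (auto simp: L)
    have "(\<Sum>k\<in>UNIV. (g x $ k) *\<^sub>R u k) - ?l = (\<Sum>k\<in>UNIV. ((\<chi> k. frac (g x $ k)) $ k) *\<^sub>R u k)"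
      by (simp add: sum_subtractf[symmetric] frac_def scaleR_left_diff_distrib)
    then have "x - ?l = (\<Sum>k\<in>UNIV. ((\<chi> k. frac (g x $ k)) $ k) *\<^sub>R u k)"
      by (simp only: g(2))
    moreover have "(\<chi> k. frac (g x $ k)) \<in> cbox 0 (1 :: real^'d)"
      by (auto simp: mem_box_cart frac_lt_1 less_imp_le)
    ultimately show "x - ?l \<in> F"
      unfolding F_def by blast
  qed
  ultimately show thesis by (rule that)
qed

lemma carrier_euclidean_group: "carrier euclidean_group = UNIV"
  by (simp add: euclidean_group_def)

lemma inv_euclidean_group: "inv\<^bsub>euclidean_group\<^esub> x = - x"
  by (rule group.inv_equality[OF group_euclidean_group]) (auto simp: euclidean_group_def)

text \<open>
  The graph is discrete because \<open>L\<close> is, and it is cocompact because a point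
  \<open>(x, h)\<close> can be moved by an element of the graph over \<open>L\<close> to bring \<open>x\<close> into a compact
  fundamental region, while the second coordinate ranges over a compact space anyway.
\<close>

lemma cocompact_lattice_graph:
  fixes u :: "'d::finite \<Rightarrow> real^'d" and K :: "('k, 'b) monoid_scheme"
  assumes L: "lattice_basis u L" and K: "lca_group K T" and cpt: "compact_space T"
    and \<phi>: "\<And>x. x \<in> L \<Longrightarrow> \<phi> x \<in> carrier K"
    and add: "\<And>x y. x \<in> L \<Longrightarrow> y \<in> L \<Longrightarrow> \<phi> (x + y) = \<phi> x \<otimes>\<^bsub>K\<^esub> \<phi> y"
  shows "cocompact_lattice (euclidean_group \<times>\<times> K) (prod_topology euclidean T)
    ((\<lambda>x. (x, \<phi> x)) ` L)"
proof -
  interpret K: comm_group K using lca_group_dest[OF K] by simp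
  let ?G = "(euclidean_group :: (real^'d) monoid) \<times>\<times> K" and ?X = "prod_topology (euclidean :: (real^'d) topology) T"
  let ?\<Lambda> = "(\<lambda>x. (x, \<phi> x)) ` L"
  have G: "lca_group ?G ?X" by (rule lca_group_DirProd[OF lca_group_euclidean K])
  interpret G: comm_group ?G using lca_group_dest[OF G] by simp
  note t = lca_group_dest(2)[OF K]
  note Lc = lattice_basis_add_closed[OF L]
  have \<phi>0: "\<phi> 0 = \<one>\<^bsub>K\<^esub>"
    using add[OF Lc(1) Lc(1)] \<phi>[OF Lc(1)] K.r_cancel_one' by simp
  have \<phi>inv: "inv\<^bsub>K\<^esub> \<phi> x = \<phi> (- x)" if "x \<in> L" for x
    using add[of "- x" x] that Lc \<phi> \<phi>0 by (intro K.inv_equality) auto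
  have sub: "subgroup ?\<Lambda> ?G"
  proof (rule G.subgroupI)
    show "?\<Lambda> \<subseteq> carrier ?G" using \<phi> by (auto simp: euclidean_group_def)
    show "?\<Lambda> \<noteq> {}" using Lc by auto
    show "inv\<^bsub>?G\<^esub> a \<in> ?\<Lambda>" if "a \<in> ?\<Lambda>" for a
    proof -
      from that obtain x where x: "x \<in> L" "a = (x, \<phi> x)" by blast
      then have "inv\<^bsub>?G\<^esub> a = (- x, \<phi> (- x))"
        using \<phi>
        by (simp add: inv_DirProd[OF group_euclidean_group K.is_group] inv_euclidean_group \<phi>inv
            carrier_euclidean_group)
      then show ?thesis using x Lc by blast
    qed
    show "a \<otimes>\<^bsub>?G\<^esub> b \<in> ?\<Lambda>" if "a \<in> ?\<Lambda>" "b \<in> ?\<Lambda>" for a b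
    proof -
      from that obtain x y where xy: "x \<in> L" "y \<in> L" "a = (x, \<phi> x)" "b = (y, \<phi> y)" by blast
      then have "a \<otimes>\<^bsub>?G\<^esub> b = (x + y, \<phi> (x + y))"
        using add by (simp add: euclidean_group_def)
      then show ?thesis using xy Lc(2)[of x y] by blast
    qed
  qed
  moreover have "subtopology ?X ?\<Lambda> = discrete_topology ?\<Lambda>"
  proof -
    obtain e where e: "e > 0" "\<And>x. x \<in> L \<Longrightarrow> norm x < e \<Longrightarrow> x = 0"
      by (rule lattice_basis_separated[OF L]) (rule that)
    have "openin (subtopology ?X ?\<Lambda>) {(x, \<phi> x)}" if x: "x \<in> L" for x
    proof -
      have "openin ?X (ball x e \<times> topspace T)"
        by (simp add: openin_prod_Times_iff)
      moreover have "(ball x e \<times> topspace T) \<inter> ?\<Lambda> = {(x, \<phi> x)}"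
      proof -
        have near: "y = x" if "y \<in> L" "dist x y < e" for y
          using e(2)[of "x - y"] Lc x that by (simp add: dist_norm)
        then show ?thesis using x e(1) \<phi> t by (auto dest: near)
      qed
      ultimately show ?thesis by (auto simp: openin_subtopology)
    qed
    moreover have "topspace (subtopology ?X ?\<Lambda>) = ?\<Lambda>"
      using \<phi> t by auto
    ultimately show ?thesis
      using discrete_topology_unique[of ?\<Lambda> "subtopology ?X ?\<Lambda>"] by auto
  qed
  moreover have "\<exists>Y. quotient_map ?X Y (\<lambda>x. ?\<Lambda> #>\<^bsub>?G\<^esub> x) \<and> compact_space Y"
  proof -
    obtain Y where Y: "quotient_map ?X Y (\<lambda>x. ?\<Lambda> #>\<^bsub>?G\<^esub> x)"
      by (rule quotient_map_exists)
    obtain F :: "(real^'d) set" where F: "compact F" "\<And>x. \<exists>l\<in>L. x - l \<in> F"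
      by (rule lattice_basis_decompose[OF L]) (rule that)
    have "compactin ?X (F \<times> topspace T)"
      using F cpt by (simp add: compactin_Times compact_space_def)
    then have "compactin Y ((\<lambda>x. ?\<Lambda> #>\<^bsub>?G\<^esub> x) ` (F \<times> topspace T))"
      using image_compactin Y quotient_imp_continuous_map by blast
    moreover have "(\<lambda>x. ?\<Lambda> #>\<^bsub>?G\<^esub> x) ` (F \<times> topspace T) = topspace Y"
    proof
      show "(\<lambda>x. ?\<Lambda> #>\<^bsub>?G\<^esub> x) ` (F \<times> topspace T) \<subseteq> topspace Y"
        using quotient_imp_surjective_map[OF Y] by auto
      show "topspace Y \<subseteq> (\<lambda>x. ?\<Lambda> #>\<^bsub>?G\<^esub> x) ` (F \<times> topspace T)"
      proof
        fix c assume "c \<in> topspace Y"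
        then have "c \<in> (\<lambda>x. ?\<Lambda> #>\<^bsub>?G\<^esub> x) ` topspace ?X"
          by (simp only: quotient_imp_surjective_map[OF Y])
        then obtain p where "p \<in> topspace ?X" "c = ?\<Lambda> #>\<^bsub>?G\<^esub> p"
          by (rule imageE)
        then obtain x h where c: "h \<in> carrier K" "c = ?\<Lambda> #>\<^bsub>?G\<^esub> (x, h)"
          by (cases p) (simp add: t)
        obtain l where l: "l \<in> L" "x - l \<in> F" using F by blast
        let ?y = "(x - l, inv\<^bsub>K\<^esub> \<phi> l \<otimes>\<^bsub>K\<^esub> h)"
        have "(x, h) = (l, \<phi> l) \<otimes>\<^bsub>?G\<^esub> ?y"
          using c l \<phi> K.m_assoc[of "\<phi> l" "inv\<^bsub>K\<^esub> \<phi> l" h, symmetric] by (simp add: euclidean_group_def)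
        then have "(x, h) \<in> ?\<Lambda> #>\<^bsub>?G\<^esub> ?y"
          using l by (auto simp: r_coset_def)
        then have "c = ?\<Lambda> #>\<^bsub>?G\<^esub> ?y"
          using G.repr_independence[OF _ _ sub] c l \<phi> by (auto simp: euclidean_group_def)
        then show "c \<in> (\<lambda>x. ?\<Lambda> #>\<^bsub>?G\<^esub> x) ` (F \<times> topspace T)"
          using l c \<phi> t by auto
      qed
    qed
    ultimately show ?thesis
      using Y by (auto simp: compact_space_def)
  qed
  ultimately show ?thesis
    by (simp add: cocompact_lattice_def)
qed

section \<open>Model sets from compactifications of a lattice\<close>

text \<open>
  Let \<open>K\<close> be a compact group containing an injective image of \<open>L\<close>. The closure of that image,
  together with the graph of \<open>\<phi>\<close>, is a cut and project scheme that projects onto all of \<open>L\<close>.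
  In a compact group every set has compact closure, so a window can be any set with an interior
  point. The window \<open>\<phi> ` A \<union> W\<close> yields \<open>A\<close>: injectivity prevents \<open>\<phi> ` A\<close> from
  selecting other points, and \<open>W\<close> selects points of \<open>A\<close> by hypothesis.
\<close>

lemma model_set_of_compact_group:
  fixes u :: "'d::finite \<Rightarrow> real^'d" and K :: "('k, 'b) monoid_scheme"
  assumes L: "lattice_basis u L" and K: "lca_group K T" and cpt: "compact_space T"
    and \<phi>: "\<And>x. x \<in> L \<Longrightarrow> \<phi> x \<in> carrier K"
    and add: "\<And>x y. x \<in> L \<Longrightarrow> y \<in> L \<Longrightarrow> \<phi> (x + y) = \<phi> x \<otimes>\<^bsub>K\<^esub> \<phi> y"
    and inj: "inj_on \<phi> L" and A: "A \<subseteq> L"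
    and W: "openin T W" "z \<in> L" "\<phi> z \<in> W" "\<And>x. x \<in> L \<Longrightarrow> \<phi> x \<in> W \<Longrightarrow> x \<in> A"
  shows "model_set ((+) t ` A)"
proof -
  interpret K: comm_group K using lca_group_dest[OF K] by simp
  note t = lca_group_dest(2)[OF K]
  note Lc = lattice_basis_add_closed[OF L]
  define C where "C = T closure_of (\<phi> ` L)"
  define K' where "K' = K\<lparr>carrier := C\<rparr>"
  define T' where "T' = subtopology T C"
  define Lt where "Lt = (\<lambda>x. (x, \<phi> x)) ` L"
  have \<phi>0: "\<phi> 0 = \<one>\<^bsub>K\<^esub>"
    using add[OF Lc(1) Lc(1)] \<phi>[OF Lc(1)] K.r_cancel_one' by simp
  have "subgroup (\<phi> ` L) K"
  proof (rule K.subgroupI)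
    show "inv\<^bsub>K\<^esub> a \<in> \<phi> ` L" if a: "a \<in> \<phi> ` L" for a
    proof -
      from a obtain x where x: "x \<in> L" "a = \<phi> x" by blast
      then have "inv\<^bsub>K\<^esub> a = \<phi> (- x)"
        using add[of "- x" x] Lc \<phi> \<phi>0 by (intro K.inv_equality) auto
      then show ?thesis using x Lc by blast
    qed
    show "a \<otimes>\<^bsub>K\<^esub> b \<in> \<phi> ` L" if "a \<in> \<phi> ` L" "b \<in> \<phi> ` L" for a b
    proof -
      from that obtain x y where xy: "x \<in> L" "y \<in> L" "a = \<phi> x" "b = \<phi> y" by blast
      then have "a \<otimes>\<^bsub>K\<^esub> b = \<phi> (x + y)" by (simp add: add)
      then show ?thesis using xy Lc(2)[of x y] by blast
    qed
    show "\<phi> ` L \<subseteq> carrier K" using \<phi> by blast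
    show "\<phi> ` L \<noteq> {}" using Lc(1) by blast
  qed
  then have C: "subgroup C K" "closedin T C"
    unfolding C_def by (rule subgroup_closure_of[OF K]) simp
  have LC: "\<phi> ` L \<subseteq> C"
    unfolding C_def using \<phi> t by (intro closure_of_subset) auto
  have CT: "C \<subseteq> topspace T" using C(2) closedin_subset by blast
  have tT': "topspace T' = C" using CT by (auto simp: T'_def)
  have K': "lca_group K' T'"
    unfolding K'_def T'_def by (rule lca_group_closed_subgroup[OF K C])
  have cpt': "compact_space T'"
    unfolding T'_def using closedin_compact_space[OF cpt C(2)] by (rule compact_space_subtopology)
  have "cocompact_lattice (euclidean_group \<times>\<times> K') (prod_topology euclidean T') Lt"
    unfolding Lt_def using LC add by (intro cocompact_lattice_graph[OF L K' cpt']) (auto simp: K'_def)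
  moreover have "T' closure_of (snd ` Lt) = topspace T'"
  proof -
    have "snd ` Lt = \<phi> ` L" by (simp add: Lt_def image_image)
    moreover have "T' closure_of (\<phi> ` L) = C"
      using LC by (simp add: T'_def closure_of_subtopology Int_absorb1 C_def)
    ultimately show ?thesis by (simp add: tT')
  qed
  ultimately have cps: "cut_and_project_scheme K' T' Lt"
    using K' by (auto simp: cut_and_project_scheme_def Lt_def inj_on_def)
  define \<Omega> where "\<Omega> = \<phi> ` A \<union> (W \<inter> C)"
  have win: "window T' \<Omega>"
    unfolding window_def
  proof (intro conjI)
    show "\<Omega> \<subseteq> topspace T'" using A LC by (auto simp: \<Omega>_def tT')
    have "openin T' (W \<inter> C)" using W by (auto simp: T'_def openin_subtopology)
    then have "W \<inter> C \<subseteq> T' interior_of \<Omega>"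
      by (intro interior_of_maximal) (auto simp: \<Omega>_def)
    then show "T' interior_of \<Omega> \<noteq> {}" using W LC by blast
    show "compactin T' (T' closure_of \<Omega>)"
      by (rule closedin_compact_space[OF cpt']) simp
  qed
  have "projected_set Lt \<Omega> = {x \<in> L. \<phi> x \<in> \<Omega>}"
    by (force simp: projected_set_def Lt_def)
  also have "\<dots> = A"
  proof (intro equalityI subsetI)
    fix x assume "x \<in> {x \<in> L. \<phi> x \<in> \<Omega>}"
    then have x: "x \<in> L" "\<phi> x \<in> \<phi> ` A \<or> \<phi> x \<in> W" by (auto simp: \<Omega>_def)
    then show "x \<in> A" using W(4) inj_on_image_mem_iff[OF inj x(1) A] by blast
  qed (use A in \<open>auto simp: \<Omega>_def\<close>)
  finally show ?thesis
    using model_setI[OF cps win, of "(+) t ` A" t] by simp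
qed


section \<open>Enlarging a model set inside a lattice\<close>

text \<open>
  The quotient of \<open>R\<^sup>d \<times> H\<close> by a lattice is a compact group into which \<open>R\<^sup>d\<close> maps
  homomorphically, and the images of open sets of \<open>R\<^sup>d \<times> H\<close> provide its neighbourhoods of
  the identity.
\<close>

lemma torus_of_cocompact_lattice:
  fixes H :: "('h, 'b) monoid_scheme" and \<Lambda> :: "((real^'d) \<times> 'h) set"
  assumes H: "lca_group H T" and \<Lambda>: "cocompact_lattice (euclidean_group \<times>\<times> H) (prod_topology euclidean T) \<Lambda>"
  defines "G \<equiv> euclidean_group \<times>\<times> H"
  obtains Y where "lca_group (G Mod \<Lambda>) Y" "compact_space Y"
    "open_map (prod_topology euclidean T) Y (\<lambda>p. \<Lambda> #>\<^bsub>G\<^esub> p)"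
    "\<And>x. \<Lambda> #>\<^bsub>G\<^esub> (x, \<one>\<^bsub>H\<^esub>) \<in> carrier (G Mod \<Lambda>)"
    "\<And>x y. \<Lambda> #>\<^bsub>G\<^esub> (x + y, \<one>\<^bsub>H\<^esub>) = (\<Lambda> #>\<^bsub>G\<^esub> (x, \<one>\<^bsub>H\<^esub>)) \<otimes>\<^bsub>G Mod \<Lambda>\<^esub> (\<Lambda> #>\<^bsub>G\<^esub> (y, \<one>\<^bsub>H\<^esub>))"
proof -
  interpret H: comm_group H using lca_group_dest[OF H] by simp
  have G: "lca_group G (prod_topology euclidean T)"
    unfolding G_def by (rule lca_group_DirProd[OF lca_group_euclidean H])
  interpret G: comm_group G using lca_group_dest[OF G] by simp
  obtain Y where sub: "subgroup \<Lambda> G" and disc: "subtopology (prod_topology euclidean T) \<Lambda> = discrete_topology \<Lambda>"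
    and Y: "quotient_map (prod_topology euclidean T) Y (\<lambda>p. \<Lambda> #>\<^bsub>G\<^esub> p)" and cpt: "compact_space Y"
    using \<Lambda> unfolding cocompact_lattice_def G_def by blast
  interpret N: normal \<Lambda> G by (rule G.subgroup_imp_normal[OF sub])
  have car: "(x, \<one>\<^bsub>H\<^esub>) \<in> carrier G" for x
    by (simp add: G_def carrier_euclidean_group)
  show thesis
  proof (rule that)
    show "lca_group (G Mod \<Lambda>) Y"
      by (rule lca_group_quotient[OF G sub disc Y cpt])
    show "open_map (prod_topology euclidean T) Y (\<lambda>p. \<Lambda> #>\<^bsub>G\<^esub> p)"
      by (rule quotient_group_open_map[OF G sub Y])
    show "\<Lambda> #>\<^bsub>G\<^esub> (x, \<one>\<^bsub>H\<^esub>) \<in> carrier (G Mod \<Lambda>)" for x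
      unfolding carrier_FactGroup using car by blast
    have "(x, \<one>\<^bsub>H\<^esub>) \<otimes>\<^bsub>G\<^esub> (y, \<one>\<^bsub>H\<^esub>) = (x + y, \<one>\<^bsub>H\<^esub>)" for x y
      by (simp add: G_def euclidean_group_def)
    then show "\<Lambda> #>\<^bsub>G\<^esub> (x + y, \<one>\<^bsub>H\<^esub>)
        = (\<Lambda> #>\<^bsub>G\<^esub> (x, \<one>\<^bsub>H\<^esub>)) \<otimes>\<^bsub>G Mod \<Lambda>\<^esub> (\<Lambda> #>\<^bsub>G\<^esub> (y, \<one>\<^bsub>H\<^esub>))" for x y
      using N.rcos_sum[OF car car, of x y] by simp
  qed (rule cpt)
qed

lemma lattice_basis_scaleR:
  assumes L: "lattice_basis u L" and \<alpha>: "\<alpha> \<noteq> 0"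
  shows "lattice_basis (\<lambda>k. \<alpha> *\<^sub>R u k) ((*\<^sub>R) \<alpha> ` L)"
  unfolding lattice_basis_def
proof (intro conjI)
  have u: "inj u" "independent (range u)"
    and L: "L = {(\<Sum>i\<in>UNIV. of_int (c i) *\<^sub>R u i) |c. True}"
    using L by (auto simp: lattice_basis_def)
  show "inj (\<lambda>k. \<alpha> *\<^sub>R u k)"
    using u \<alpha> by (auto simp: inj_def)
  have "independent ((*\<^sub>R) \<alpha> ` range u)"
    using u \<alpha> by (intro linear_independent_injective_image linearI)
      (auto simp: inj_on_def scaleR_add_right)
  then show "independent (range (\<lambda>k. \<alpha> *\<^sub>R u k))"
    by (simp add: image_image)
  have "\<alpha> *\<^sub>R (\<Sum>i\<in>UNIV. of_int (c i) *\<^sub>R u i) = (\<Sum>i\<in>UNIV. of_int (c i) *\<^sub>R \<alpha> *\<^sub>R u i)" for c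
    by (simp add: scaleR_sum_right mult.commute)
  then show "(*\<^sub>R) \<alpha> ` L = {(\<Sum>i\<in>UNIV. of_int (c i) *\<^sub>R \<alpha> *\<^sub>R u i) |c. True}"
    by (simp add: L full_SetCompr_eq image_image)
qed

lemma continuous_map_into_unit: "continuous_map Z (discrete_topology UNIV) (f :: 'z \<Rightarrow> unit)"
proof -
  have "f = (\<lambda>_. ())" by (simp add: fun_eq_iff)
  then show ?thesis by (simp only: continuous_map_const) simp
qed

lemma lca_group_unit:
  "lca_group \<lparr>carrier = UNIV, mult = (\<lambda>_ _. ()), one = ()\<rparr> (discrete_topology UNIV)"
  unfolding lca_group_def
  by (intro conjI comm_groupI compact_imp_locally_compact_space continuous_map_into_unit)
    (auto simp: compact_space_discrete_topology)

text \<open>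
  For irrational \<open>\<alpha>\<close> the lattices \<open>L\<close> and \<open>\<alpha> L\<close> meet in \<open>0\<close> only, so \<open>L\<close> injects into
  the torus \<open>R\<^sup>d / \<alpha> L\<close>. That torus arises from the graph construction over the trivial
  group.
\<close>

lemma lattice_injects_into_compact_group:
  fixes u :: "'d::finite \<Rightarrow> real^'d"
  assumes L: "lattice_basis u L"
  obtains K :: "((real^'d) \<times> unit) set monoid" and T \<psi> where "lca_group K T" "compact_space T"
    "\<And>x. \<psi> x \<in> carrier K" "\<And>x y. \<psi> (x + y) = \<psi> x \<otimes>\<^bsub>K\<^esub> \<psi> y" "inj_on \<psi> L"
proof -
  obtain \<alpha> :: real where \<alpha>: "\<alpha> \<notin> \<rat>"
    using uncountable_UNIV_real countable_rat countable_subset[of UNIV "\<rat> :: real set"] by blast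
  then have "\<alpha> \<noteq> 0" by auto
  define M where "M = (*\<^sub>R) \<alpha> ` L"
  have M: "lattice_basis (\<lambda>k. \<alpha> *\<^sub>R u k) M"
    unfolding M_def by (rule lattice_basis_scaleR[OF L \<open>\<alpha> \<noteq> 0\<close>])
  note Lc = lattice_basis_add_closed[OF L]
  obtain g :: "real^'d \<Rightarrow> real^'d" where g: "linear g" "\<And>x. (\<Sum>k\<in>UNIV. (g x $ k) *\<^sub>R u k) = x"
    "\<And>x. x \<in> L \<longleftrightarrow> (\<forall>k. g x $ k \<in> \<int>)"
    by (rule lattice_basis_coordinates[OF L]) (rule that)
  have LM: "x = 0" if x: "x \<in> L" "x \<in> M" for x
  proof -
    obtain l where l: "l \<in> L" "x = \<alpha> *\<^sub>R l" using x by (auto simp: M_def)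
    have "g l $ k = 0" for k
    proof (rule ccontr)
      assume nz: "g l $ k \<noteq> 0"
      have "g x $ k = \<alpha> * (g l $ k)" using l g(1) by (simp add: linear_cmul)
      then have "\<alpha> = (g x $ k) / (g l $ k)" using nz by simp
      moreover have "g x $ k \<in> \<rat>" "g l $ k \<in> \<rat>"
        using x(1) l(1) g(3) Ints_subset_Rats by blast+
      ultimately show False using \<alpha> by (simp add: Rats_divide)
    qed
    then have "(\<Sum>k\<in>UNIV. (g l $ k) *\<^sub>R u k) = 0" by simp
    then show ?thesis using l by (simp add: g(2))
  qed
  define U :: "unit monoid" where "U = \<lparr>carrier = UNIV, mult = (\<lambda>_ _. ()), one = ()\<rparr>"
  define S :: "unit topology" where "S = discrete_topology UNIV"
  have cS: "compact_space S" by (simp add: S_def compact_space_discrete_topology)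
  have U: "lca_group U S" unfolding U_def S_def by (rule lca_group_unit)
  define \<Lambda> where "\<Lambda> = (\<lambda>x. (x, ())) ` M"
  define G where "G = (euclidean_group :: (real^'d) monoid) \<times>\<times> U"
  have lat: "cocompact_lattice (euclidean_group \<times>\<times> U) (prod_topology euclidean S) \<Lambda>"
    unfolding \<Lambda>_def by (rule cocompact_lattice_graph[OF M U cS]) (simp_all add: U_def)
  obtain Y where Y: "lca_group (G Mod \<Lambda>) Y" "compact_space Y"
    "open_map (prod_topology euclidean S) Y (\<lambda>p. \<Lambda> #>\<^bsub>G\<^esub> p)"
    "\<And>x. \<Lambda> #>\<^bsub>G\<^esub> (x, \<one>\<^bsub>U\<^esub>) \<in> carrier (G Mod \<Lambda>)"
    "\<And>x y. \<Lambda> #>\<^bsub>G\<^esub> (x + y, \<one>\<^bsub>U\<^esub>) = (\<Lambda> #>\<^bsub>G\<^esub> (x, \<one>\<^bsub>U\<^esub>)) \<otimes>\<^bsub>G Mod \<Lambda>\<^esub> (\<Lambda> #>\<^bsub>G\<^esub> (y, \<one>\<^bsub>U\<^esub>))"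
    by (rule torus_of_cocompact_lattice[OF U lat, folded G_def]) (rule that)
  have cG: "comm_group G"
    using lca_group_dest(1)[OF lca_group_DirProd[OF lca_group_euclidean U]] by (simp add: G_def)
  have sub: "subgroup \<Lambda> G" using lat by (simp add: cocompact_lattice_def G_def)
  have "inj_on (\<lambda>x. \<Lambda> #>\<^bsub>G\<^esub> (x, \<one>\<^bsub>U\<^esub>)) L"
  proof (rule inj_onI)
    fix x y assume xy: "x \<in> L" "y \<in> L" "\<Lambda> #>\<^bsub>G\<^esub> (x, \<one>\<^bsub>U\<^esub>) = \<Lambda> #>\<^bsub>G\<^esub> (y, \<one>\<^bsub>U\<^esub>)"
    have "(x, \<one>\<^bsub>U\<^esub>) \<otimes>\<^bsub>G\<^esub> inv\<^bsub>G\<^esub> (y, \<one>\<^bsub>U\<^esub>) \<in> \<Lambda>"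
      using xy(3) r_coset_eq_iff[OF cG sub, of "(x, \<one>\<^bsub>U\<^esub>)" "(y, \<one>\<^bsub>U\<^esub>)"]
      by (simp add: G_def carrier_euclidean_group U_def)
    moreover have "inv\<^bsub>G\<^esub> (y, \<one>\<^bsub>U\<^esub>) = (- y, \<one>\<^bsub>U\<^esub>)"
      using inv_DirProd[OF group_euclidean_group, of U y "\<one>\<^bsub>U\<^esub>"] lca_group_dest(1)[OF U]
      by (simp add: G_def carrier_euclidean_group inv_euclidean_group comm_group_def U_def)
    ultimately have "x - y \<in> M"
      by (auto simp: \<Lambda>_def G_def euclidean_group_def)
    then show "x = y" using LM[of "x - y"] Lc(4) xy by simp
  qed
  with Y(1,2,4,5) show thesis
    by (rule that)
qed

text \<open>
  Let \<open>B\<close> come from a scheme with internal group \<open>H\<close> and lattice \<open>\<Lambda>\<close>, and let \<open>z\<^sub>0 \<in> \<Lambda>\<close>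
  project to an interior point of the window. If a point \<open>x\<close> of \<open>L\<close> is close to the identity in
  the torus \<open>(R\<^sup>d \<times> H) / \<Lambda>\<close>, then \<open>x\<close> is within a short distance \<open>b\<close> of the projection
  \<open>y\<close> of some \<open>z \<in> \<Lambda>\<close> with small internal part. Then \<open>z\<^sub>0 + z\<close> still lies over the
  window, so \<open>a + y\<close> belongs to \<open>B\<close>, where \<open>a\<close> is the point of \<open>B\<close> that \<open>z\<^sub>0\<close> gives. As
  \<open>B\<close> is contained in \<open>L\<close>, so is \<open>y\<close>, and the difference \<open>b = x - y\<close> is a short vector
  of \<open>L\<close>, hence \<open>0\<close>. So a neighbourhood of the identity in the torus selects only points of \<open>B - a\<close>, hence of \<open>A - a\<close>.
  A second torus is added as a factor because \<open>L\<close> need not inject into the first one: \<open>B\<close> may be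
  periodic.
\<close>

lemma model_set_mono_in_lattice:
  fixes u :: "'d::finite \<Rightarrow> real^'d" and A B :: "(real^'d) set"
  assumes L: "lattice_basis u L" and B: "model_set B" and BA: "B \<subseteq> A" and AL: "A \<subseteq> L"
  shows "model_set A"
proof -
  obtain H :: "(real^'d) set set monoid" and T Lt \<Omega> t
    where cps: "cut_and_project_scheme H T Lt" and win: "window T \<Omega>"
      and Beq: "B = (+) t ` projected_set Lt \<Omega>"
    using B unfolding model_set_def by blast
  have H: "lca_group H T" and lat: "cocompact_lattice (euclidean_group \<times>\<times> H) (prod_topology euclidean T) Lt"
    and dense: "T closure_of (snd ` Lt) = topspace T"
    using cps by (auto simp: cut_and_project_scheme_def)
  interpret H: comm_group H using lca_group_dest[OF H] by simp
  note tT = lca_group_dest(2)[OF H]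
  note Lc = lattice_basis_add_closed[OF L]
  define G where "G = (euclidean_group :: (real^'d) monoid) \<times>\<times> H"
  have sub: "subgroup Lt G" using lat by (simp add: cocompact_lattice_def G_def)
  have LtH: "snd z \<in> carrier H" if "z \<in> Lt" for z
    using subgroup.subset[OF sub] that by (auto simp: G_def)
  define U where "U = T interior_of \<Omega>"
  have U: "openin T U" "U \<noteq> {}" "U \<subseteq> \<Omega>"
    using win by (auto simp: U_def window_def interior_of_subset)
  obtain z0 where z0: "z0 \<in> Lt" "snd z0 \<in> U"
    using dense U openin_subset[OF U(1)] unfolding dense_intersects_open by blast
  have inB: "t + fst z \<in> B" if "z \<in> Lt" "snd z \<in> U" for z
    using that U by (auto simp: Beq projected_set_def)
  define a where "a = t + fst z0"
  have aL: "a \<in> L" using inB[OF z0] BA AL by (auto simp: a_def)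
  obtain e where e: "e > 0" "\<And>x. x \<in> L \<Longrightarrow> norm x < e \<Longrightarrow> x = 0"
    by (rule lattice_basis_separated[OF L]) (rule that)
  obtain Y where Y: "lca_group (G Mod Lt) Y" "compact_space Y"
    "open_map (prod_topology euclidean T) Y (\<lambda>p. Lt #>\<^bsub>G\<^esub> p)"
    "\<And>x. Lt #>\<^bsub>G\<^esub> (x, \<one>\<^bsub>H\<^esub>) \<in> carrier (G Mod Lt)"
    "\<And>x y. Lt #>\<^bsub>G\<^esub> (x + y, \<one>\<^bsub>H\<^esub>) = (Lt #>\<^bsub>G\<^esub> (x, \<one>\<^bsub>H\<^esub>)) \<otimes>\<^bsub>G Mod Lt\<^esub> (Lt #>\<^bsub>G\<^esub> (y, \<one>\<^bsub>H\<^esub>))"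
    by (rule torus_of_cocompact_lattice[OF H lat, folded G_def]) (rule that)
  obtain K :: "((real^'d) \<times> unit) set monoid" and S \<psi> where K: "lca_group K S" "compact_space S"
    "\<And>x. \<psi> x \<in> carrier K" "\<And>x y. \<psi> (x + y) = \<psi> x \<otimes>\<^bsub>K\<^esub> \<psi> y" "inj_on \<psi> L"
    by (rule lattice_injects_into_compact_group[OF L]) (rule that)
  \<comment> \<open>The inverse makes \<open>N\<close> match the internal part of \<open>z\<close> when \<open>(x, 1)\<close> is written as \<open>z\<close> times
    a small element: that internal part is the inverse of the one of the small element.\<close>
  define N where "N = ball (0 :: real^'d) e \<times> {h \<in> topspace T. snd z0 \<otimes>\<^bsub>H\<^esub> inv\<^bsub>H\<^esub> h \<in> U}"
  have "openin T {h \<in> topspace T. snd z0 \<otimes>\<^bsub>H\<^esub> inv\<^bsub>H\<^esub> h \<in> U}"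
  proof (rule openin_continuous_map_preimage[OF _ U(1)])
    show "continuous_map T T (\<lambda>h. snd z0 \<otimes>\<^bsub>H\<^esub> inv\<^bsub>H\<^esub> h)"
      using LtH[OF z0(1)] tT
      by (intro lca_group_continuous_mult[OF H] lca_group_continuous_inv[OF H]) auto
  qed
  then have N: "openin (prod_topology euclidean T) N"
    by (simp add: N_def openin_prod_Times_iff)
  define W where "W = ((\<lambda>p. Lt #>\<^bsub>G\<^esub> p) ` N) \<times> topspace S"
  define \<phi> where "\<phi> x = (Lt #>\<^bsub>G\<^esub> (x, \<one>\<^bsub>H\<^esub>), \<psi> x)" for x
  have near: "x + a \<in> B" if x: "x \<in> L" "Lt #>\<^bsub>G\<^esub> (x, \<one>\<^bsub>H\<^esub>) \<in> (\<lambda>p. Lt #>\<^bsub>G\<^esub> p) ` N" for x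
  proof -
    obtain b h where bh: "(b, h) \<in> N" "Lt #>\<^bsub>G\<^esub> (x, \<one>\<^bsub>H\<^esub>) = Lt #>\<^bsub>G\<^esub> (b, h)"
      using x(2) by auto
    have h: "h \<in> carrier H" "norm b < e" "snd z0 \<otimes>\<^bsub>H\<^esub> inv\<^bsub>H\<^esub> h \<in> U"
      using bh(1) by (auto simp: N_def tT)
    have cG: "comm_group G"
      using lca_group_dest(1)[OF lca_group_DirProd[OF lca_group_euclidean H]] by (simp add: G_def)
    have "(x, \<one>\<^bsub>H\<^esub>) \<otimes>\<^bsub>G\<^esub> inv\<^bsub>G\<^esub> (b, h) \<in> Lt"
      using bh(2) r_coset_eq_iff[OF cG sub, of "(x, \<one>\<^bsub>H\<^esub>)" "(b, h)"] h
      by (simp add: G_def carrier_euclidean_group)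
    moreover have "inv\<^bsub>G\<^esub> (b, h) = (- b, inv\<^bsub>H\<^esub> h)"
      using inv_DirProd[OF group_euclidean_group H.is_group, of b h] h
      by (simp add: G_def carrier_euclidean_group inv_euclidean_group)
    ultimately have "(x - b, inv\<^bsub>H\<^esub> h) \<in> Lt"
      using h by (simp add: G_def euclidean_group_def)
    then have "z0 \<otimes>\<^bsub>G\<^esub> (x - b, inv\<^bsub>H\<^esub> h) \<in> Lt"
      using subgroup.m_closed[OF sub z0(1)] by blast
    moreover have "z0 \<otimes>\<^bsub>G\<^esub> (x - b, inv\<^bsub>H\<^esub> h) = (fst z0 + (x - b), snd z0 \<otimes>\<^bsub>H\<^esub> inv\<^bsub>H\<^esub> h)"
      by (simp add: G_def mult_DirProd' euclidean_group_def)
    ultimately have xb: "a + (x - b) \<in> B"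
      using inB[of "(fst z0 + (x - b), snd z0 \<otimes>\<^bsub>H\<^esub> inv\<^bsub>H\<^esub> h)"] h by (simp add: a_def add.assoc)
    then have "x - (a + (x - b) - a) \<in> L"
      using BA AL aL x Lc(4) by blast
    then have "b = 0" using e(2)[of b] h by simp
    then show ?thesis using xb by (simp add: add.commute)
  qed
  have "model_set ((+) a ` ((\<lambda>x. x - a) ` A))"
  proof (rule model_set_of_compact_group[OF L, of "(G Mod Lt) \<times>\<times> K" "prod_topology Y S" \<phi> _ W 0])
    show "lca_group ((G Mod Lt) \<times>\<times> K) (prod_topology Y S)"
      by (rule lca_group_DirProd[OF Y(1) K(1)])
    show "compact_space (prod_topology Y S)"
      using Y(2) K(2) by (simp add: compact_space_prod_topology)
    show "\<phi> x \<in> carrier ((G Mod Lt) \<times>\<times> K)" for x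
      using Y(4) K(3) by (simp add: \<phi>_def)
    show "\<phi> (x + y) = \<phi> x \<otimes>\<^bsub>(G Mod Lt) \<times>\<times> K\<^esub> \<phi> y" for x y
      using Y(5) K(4) by (simp add: \<phi>_def)
    show "inj_on \<phi> L"
      using K(5) by (auto simp: \<phi>_def inj_on_def)
    show "(\<lambda>x. x - a) ` A \<subseteq> L"
      using AL aL Lc(4) by auto
    show "openin (prod_topology Y S) W"
      unfolding W_def openin_prod_Times_iff using Y(3) N by (auto simp: open_map_def)
    show "0 \<in> L" by (rule Lc(1))
    have "(0, \<one>\<^bsub>H\<^esub>) \<in> N"
      using e(1) z0 LtH by (simp add: N_def tT)
    then show "\<phi> 0 \<in> W"
      using K(3)[of 0] lca_group_dest(2)[OF K(1)] by (auto simp: \<phi>_def W_def)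
    show "x \<in> (\<lambda>x. x - a) ` A" if "x \<in> L" "\<phi> x \<in> W" for x
      using near[of x] that BA by (auto simp: \<phi>_def W_def intro!: image_eqI[of _ _ "x + a"])
  qed
  then show ?thesis
    by (simp add: image_image)
qed

section \<open>From the derived system to the original one\<close>

text \<open>
  By primitivity every component contains an image of every other one.
\<close>

lemma components_nonempty:
  assumes fixed: "\<And>i. i < m \<Longrightarrow> mfs_apply m \<Phi> V i = V i" and "primitive_mfs m \<Phi>"
    and "supp m V \<noteq> {}" and "i < m"
  shows "V i \<noteq> {}"
proof -
  obtain k where k: "\<And>i j. i < m \<Longrightarrow> j < m \<Longrightarrow> matrix_power m (substitution_matrix \<Phi>) k i j > 0"
    using assms(2) by (auto simp: primitive_mfs_def)
  obtain j where j: "j < m" "V j \<noteq> {}"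
    using assms(3) by (auto simp: supp_def)
  have "V i \<noteq> {}" if "matrix_power m (substitution_matrix \<Phi>) k i j > 0" "i < m" "j < m" "V j \<noteq> {}" for k i j
    using that
  proof (induction k arbitrary: j)
    case 0
    then show ?case by (auto split: if_splits)
  next
    case (Suc k)
    have "(\<Sum>l<m. matrix_power m (substitution_matrix \<Phi>) k i l * substitution_matrix \<Phi> l j) \<noteq> 0"
      using Suc.prems(1) by (simp only: matrix_power.simps neq0_conv)
    then obtain l where "l \<in> {..<m}" "matrix_power m (substitution_matrix \<Phi>) k i l * substitution_matrix \<Phi> l j \<noteq> 0"
      by (rule sum.not_neutral_contains_not_neutral) (rule that)
    then have l: "l < m" "matrix_power m (substitution_matrix \<Phi>) k i l * substitution_matrix \<Phi> l j > 0"
      by simp_all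
    then have "\<Phi> l j \<noteq> {}"
      by (auto simp: substitution_matrix_def)
    then have "mfs_apply m \<Phi> V l \<noteq> {}"
      using Suc.prems by (auto simp: mfs_apply_def)
    then have "V l \<noteq> {}" using fixed l by simp
    then show ?case using Suc.IH[of l] Suc.prems l by simp
  qed
  then show ?thesis using k j assms(4) by blast
qed

text \<open>
  Since \<open>R > 0\<close>, the cluster around a point records the type of its centre.
\<close>

lemma derived_component_subset:
  assumes der: "derived_system m Q V F R n C V' \<Phi>'" and "R > 0" and "i < m" and "V i \<noteq> {}"
  shows "\<exists>j<n. V' j \<subseteq> V i"
proof -
  obtain x where x: "x \<in> V i" using assms by blast
  then have "x \<in> supp m V" using \<open>i < m\<close> by (auto simp: supp_def)
  then obtain j where j: "j < n" "has_cluster m V R x (C j)"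
    using der by (auto simp: derived_system_def cluster_representatives_def)
  have mem: "y \<in> V i \<longleftrightarrow> 0 \<in> C j i" if "has_cluster m V R y (C j)" for y
  proof -
    have "cut V (cball y R) i = (+) y ` C j i"
      using that \<open>i < m\<close> by (simp add: has_cluster_def)
    moreover have "y \<in> V i \<longleftrightarrow> y \<in> cut V (cball y R) i"
      using \<open>R > 0\<close> by (simp add: cut_def)
    ultimately show ?thesis by auto
  qed
  have "V' j \<subseteq> V i"
    using der j x mem by (auto simp: derived_system_def)
  then show ?thesis using j by blast
qed

theorem theorem4p12:
  fixes Q :: "real^'d^'d" and u :: "'d \<Rightarrow> real^'d" and R :: real
    and V V' :: "nat \<Rightarrow> (real^'d) set"
    and \<Phi> \<Phi>' :: "nat \<Rightarrow> nat \<Rightarrow> (real^'d \<Rightarrow> real^'d) set"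
    and C :: "nat \<Rightarrow> nat \<Rightarrow> (real^'d) set" and m n :: nat
  assumes "lattice_substitution_system m Q V \<Phi>"
    and "primitive_mfs m \<Phi>"
    and "clusters_from_points m V \<Phi>"
    and "lattice_basis u (supp m V)"
    and "nicely_growing m Q V \<Phi> (fundamental_parallelepiped u)"
    and "nicely_growing_with m Q V \<Phi> (fundamental_parallelepiped u) R"
    and "derived_system m Q V (fundamental_parallelepiped u) R n C V' \<Phi>'"
    and "\<forall>i<n. model_set (V' i)"
  shows "\<forall>i<m. model_set (V i)"
proof (intro allI impI)
  fix i assume i: "i < m"
  have "supp m V \<noteq> {}"
    using lattice_basis_add_closed(1)[OF assms(4)] by blast
  then have "V i \<noteq> {}"
    using components_nonempty[OF _ assms(2) _ i] assms(1) by (auto simp: lattice_substitution_system_def)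
  then obtain j where j: "j < n" "V' j \<subseteq> V i"
    using derived_component_subset[OF assms(7) _ i] assms(6) by (auto simp: nicely_growing_with_def)
  have "V i \<subseteq> supp m V" using i by (auto simp: supp_def)
  then show "model_set (V i)"
    using model_set_mono_in_lattice[OF assms(4) _ j(2)] assms(8) j(1) by blast
qed

end
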